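(* Let $X$ be an origami and assume that there exists a constant $\mathcal K>0$ such that for any origami $Y\in \mathrm{SL}(2,\mathbb Z)\cdot X$ and any pair of segments $H,V\subset Y$ we have $H\cap V\neq\emptyset$ whenever they have length $|H|,|V|\geq\mathcal K$ and satisfy - either $\mathrm{Slope}(H)<-1$ and $0<\mathrm{Slope}(V)<1$, - or $-1<\mathrm{Slope}(H)<0$ and $\mathrm{Slope}(V)>1$. Then $H(X,\alpha,p)=w(\alpha)$ for any irrational $\alpha$ and any $p\in X$ outside the singular leaves of the linear flow $\phi_\alpha$ on $X$, where $H(X,\alpha,p)$ is the hitting time and $w(\alpha)$ is the diophantine type of $\alpha$.
   Context: **Origamis.** Let $\mathcal Q$ be a finite set and $(h,v)$ a pair of permutations of $\mathcal Q$ generating a transitive subgroup of the symmetric group. The origami $X$ defined by $(h,v)$ is the surface obtained from the squares $Q_j=\{j\}\times[0,1]^2$, $j\in\mathcal Q$, by gluing (by translation), for every $j$, the right side of $Q_j$ to the left side of $Q_{h(j)}$ and the top side of $Q_j$ to the bottom side of $Q_{v(j)}$. The map $(j,x)\mapsto [x]$ induces a covering $\rho_X:X\to\mathbb T^2=\mathbb R^2/\mathbb Z^2$, ramified only over $[0]$. The points $p_1,\dots,p_m$ of $X$ where $\rho_X$ is ramified are the conical points; $X$ inherits a metric which is flat outside these points and has conical angle $2(k_j+1)\pi$ at $p_j$, where $k_j+1$ is the ramification index ($k_j\ge 1$). $\mathrm{Dist}(\cdot,\cdot)$ denotes the corresponding distance on $X$, which equals the euclidean distance on small enough discs in $X\setminus\{p_1,\dots,p_m\}$.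 **Action of $\mathrm{SL}(2,\mathbb Z)$.** For $A\in\mathrm{SL}(2,\mathbb Z)$, the surface $A\cdot X$ is obtained from the parallelograms $P_j=\{j\}\times A([0,1]^2)$, $j\in\mathcal Q$, by gluing the images under $A$ of the sides of the squares with the same identifications as in $X$ (image of right side of $Q_j$ to image of left side of $Q_{h(j)}$, image of top side of $Q_j$ to image of bottom side of $Q_{v(j)}$). $A\cdot X$ is again an origami. It is determined by $(h,v)\mapsto(h,v\circ h^{-1})$ for $A=\begin{pmatrix}1&1\\0&1\end{pmatrix}$ and $(h,v)\mapsto(h\circ v^{-1},v)$ for $A=\begin{pmatrix}1&0\\1&1\end{pmatrix}$. $\mathrm{SL}(2,\mathbb Z)\cdot X$ is the orbit of $X$. **Segments.** A (straight) segment in $X$ is a smooth path $S:(a,b)\to X\setminus\{p_1,\dots,p_m\}$ such that for some vector $u=(x,y)\in\mathbb R^2$ one has $\frac{d}{dt}\rho_X(S(t))=u$ for all $t\in(a,b)$. Its slope is $\mathrm{Slope}(S)=x/y\in\mathbb R\cup\{\pm\infty\}$ and its length is $|S|=|b-a|\cdot\|u\|$ (euclidean norm). Endpoints of segments can be conical points. **Linear flow.** For $\alpha\in\mathbb R\cup\{\infty\}$ let $\theta=\arctan\alpha\in(-\pi/2,\pi/2]$ and $e_\alpha=(\sin\theta,\cos\theta)$ (so slope $0$ is vertical). The linear flow $\phi_\alpha$ on $X$ is the continuous flow determined by $\rho_X(\phi_\alpha(t,p))=\rho_X(p)+te_\alpha \bmod \mathbb Z^2$. There are $k_j+1$ trajectories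 starting at each conical point $p_j$ and $k_j+1$ trajectories ending at $p_j$ (trajectories stop when they hit a conical point); these are called the singular leaves. The flow is a regular $\mathbb R$-action outside singular leaves. **Diophantine type.** $w(\alpha)=\sup\{w>0: |\alpha-p/q|<q^{-(w+1)}\text{ for infinitely many }p/q\in\mathbb Q\}$, with $p,q$ coprime. **Hitting time.** For $p\in X$ and $r>0$, $$T(X,\alpha,p,r)=\sup_{\widetilde p\in X}\ \inf\{t>r:\mathrm{Dist}(\phi_\alpha(t,p),\widetilde p)<r\},$$ and $$H(X,\alpha,p)=\limsup_{r\to0^+}\frac{\log T(X,\alpha,p,r)}{-\log r}.$$ *)

theory Defs
  imports "HOL-Analysis.Analysis"
begin

section \<open>Origamis and their images under SL(2,Z)\<close>

text \<open>
  A tiled surface consists of the parallelograms \<open>{j} \<times> A([0,1]\<^sup>2)\<close>, for \<open>j\<close> in \<open>tiles\<close> and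
  \<open>A = frame\<close>, glued along their sides according to the permutations \<open>hperm\<close> and \<open>vperm\<close>. An origami
  is the case \<open>A = mat 1\<close>; the surface \<open>A \<cdot> X\<close> differs from \<open>X\<close> only in the frame.
\<close>

record 'q tiled_surface =
  tiles :: "'q set"
  hperm :: "'q \<Rightarrow> 'q"
  vperm :: "'q \<Rightarrow> 'q"
  frame :: "real^2^2"

inductive_set generated_perms :: "('q \<Rightarrow> 'q) \<Rightarrow> ('q \<Rightarrow> 'q) \<Rightarrow> ('q \<Rightarrow> 'q) set"
  for h v :: "'q \<Rightarrow> 'q" where
  "id \<in> generated_perms h v"
| "g \<in> generated_perms h v \<Longrightarrow> h \<circ> g \<in> generated_perms h v"
| "g \<in> generated_perms h v \<Longrightarrow> inv h \<circ> g \<in> generated_perms h v"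
| "g \<in> generated_perms h v \<Longrightarrow> v \<circ> g \<in> generated_perms h v"
| "g \<in> generated_perms h v \<Longrightarrow> inv v \<circ> g \<in> generated_perms h v"

definition origami :: "'q tiled_surface \<Rightarrow> bool" where
  "origami X \<longleftrightarrow>
     finite (tiles X) \<and> tiles X \<noteq> {} \<and>
     hperm X permutes tiles X \<and> vperm X permutes tiles X \<and>
     (\<forall>i\<in>tiles X. \<forall>j\<in>tiles X. \<exists>g\<in>generated_perms (hperm X) (vperm X). g i = j) \<and>
     frame X = mat 1"

definition SL2Z :: "(real^2^2) set" where
  "SL2Z = {A. (\<forall>i j. A $ i $ j \<in> \<int>) \<and> det A = 1}"

definition act :: "real^2^2 \<Rightarrow> 'q tiled_surface \<Rightarrow> 'q tiled_surface" where
  "act A X = X\<lparr>frame := A ** frame X\<rparr>"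

definition SL2Z_orbit :: "'q tiled_surface \<Rightarrow> 'q tiled_surface set" where
  "SL2Z_orbit X = {act A X | A. A \<in> SL2Z}"


section \<open>The glued surface\<close>

definition tile_points :: "'q tiled_surface \<Rightarrow> ('q \<times> (real^2)) set" where
  "tile_points S = tiles S \<times> (*v) (frame S) ` cbox 0 1"

definition side_glue :: "'q tiled_surface \<Rightarrow> (('q \<times> (real^2)) \<times> ('q \<times> (real^2))) set" where
  "side_glue S =
     {((j, frame S *v vector [1, y]), (hperm S j, frame S *v vector [0, y])) | j y.
        j \<in> tiles S \<and> 0 \<le> y \<and> y \<le> 1} \<union>
     {((j, frame S *v vector [x, 1]), (vperm S j, frame S *v vector [x, 0])) | j x.
        j \<in> tiles S \<and> 0 \<le> x \<and> x \<le> 1}"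

definition glue :: "'q tiled_surface \<Rightarrow> (('q \<times> (real^2)) \<times> ('q \<times> (real^2))) set" where
  "glue S = Restr ((side_glue S \<union> (side_glue S)\<inverse>)\<^sup>*) (tile_points S)"

type_synonym 'q point = "('q \<times> (real^2)) set"

definition points :: "'q tiled_surface \<Rightarrow> 'q point set" where
  "points S = tile_points S // glue S"

text \<open>
  Points of the torus are represented as cosets \<open>x + \<int>\<^sup>2\<close>, so adding a vector to a point of the torus
  is taking the image of the coset under a translation.
\<close>

definition torus :: "real^2 \<Rightarrow> (real^2) set" where
  "torus x = {x + n | n. \<forall>i. n $ i \<in> \<int>}"

text \<open>
  The covering \<open>\<rho>\<close>. When the frame has integer entries, all \<open>(j, x)\<close> in one gluing class have the
  same \<open>torus x\<close>, so the union below is a single coset.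
\<close>

definition rho :: "'q point \<Rightarrow> (real^2) set" where
  "rho p = (\<Union>(j, x)\<in>p. torus x)"

text \<open>
  \<open>broken_path S p q l\<close>: a path of length \<open>l\<close> from \<open>p\<close> to \<open>q\<close> made of finitely many straight pieces,
  each contained in one (convex) tile. The flat distance on \<open>S\<close> is the infimum of such lengths.
\<close>

inductive broken_path :: "'q tiled_surface \<Rightarrow> 'q point \<Rightarrow> 'q point \<Rightarrow> real \<Rightarrow> bool"
  for S :: "'q tiled_surface" and p :: "'q point" where
  "p \<in> points S \<Longrightarrow> broken_path S p p 0"
| "broken_path S p q l \<Longrightarrow> q' \<in> points S \<Longrightarrow> (j, x) \<in> q \<Longrightarrow> (j, y) \<in> q' \<Longrightarrow>
     broken_path S p q' (l + dist x y)"

definition Dist :: "'q tiled_surface \<Rightarrow> 'q point \<Rightarrow> 'q point \<Rightarrow> real" where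
  "Dist S p q = Inf {l. broken_path S p q l}"

definition continuous_path :: "'q tiled_surface \<Rightarrow> real set \<Rightarrow> (real \<Rightarrow> 'q point) \<Rightarrow> bool" where
  "continuous_path S I \<gamma> \<longleftrightarrow>
     (\<forall>t\<in>I. \<gamma> t \<in> points S) \<and>
     (\<forall>t\<in>I. ((\<lambda>s. Dist S (\<gamma> s) (\<gamma> t)) \<longlongrightarrow> 0) (at t within I))"

text \<open>Conical points are those where \<open>\<rho>\<close> is ramified, that is, not locally injective.\<close>

definition conical_points :: "'q tiled_surface \<Rightarrow> 'q point set" where
  "conical_points S =
     {p \<in> points S. \<not> (\<exists>e>0. inj_on rho {q \<in> points S. Dist S p q < e})}"


section \<open>Segments\<close>

text \<open>The derivative of a path in the torus is that of a local lift to the plane.\<close>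

definition has_torus_derivative ::
    "(real \<Rightarrow> (real^2) set) \<Rightarrow> real^2 \<Rightarrow> real \<Rightarrow> bool" where
  "has_torus_derivative f u t \<longleftrightarrow>
     (\<exists>g. (\<forall>\<^sub>F s in nhds t. f s = torus (g s)) \<and> (g has_vector_derivative u) (at t))"

text \<open>A path together with its interval of definition and its velocity vector.\<close>

record 'q segment =
  seg_start :: real
  seg_end :: real
  seg_path :: "real \<Rightarrow> 'q point"
  seg_velocity :: "real^2"

definition seg_domain :: "'q segment \<Rightarrow> real set" where
  "seg_domain c = {seg_start c <..< seg_end c}"

definition is_segment :: "'q tiled_surface \<Rightarrow> 'q segment \<Rightarrow> bool" where
  "is_segment S c \<longleftrightarrow>
     seg_start c < seg_end c \<and>
     continuous_path S (seg_domain c) (seg_path c) \<and>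
     (\<forall>t\<in>seg_domain c.
        seg_path c t \<notin> conical_points S \<and>
        has_torus_derivative (\<lambda>s. rho (seg_path c s)) (seg_velocity c) t)"

definition seg_trace :: "'q segment \<Rightarrow> 'q point set" where
  "seg_trace c = seg_path c ` seg_domain c"

definition seg_length :: "'q segment \<Rightarrow> real" where
  "seg_length c = \<bar>seg_end c - seg_start c\<bar> * norm (seg_velocity c)"

text \<open>In the extended reals \<open>x / 0\<close> is \<open>\<infinity>\<close> for \<open>x > 0\<close> and \<open>-\<infinity>\<close> for \<open>x < 0\<close>.\<close>

definition seg_slope :: "'q segment \<Rightarrow> ereal" where
  "seg_slope c = ereal (seg_velocity c $ 1) / ereal (seg_velocity c $ 2)"


section \<open>The linear flow\<close>

definition direction :: "real \<Rightarrow> real^2" where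
  "direction \<alpha> = vector [sin (arctan \<alpha>), cos (arctan \<alpha>)]"

text \<open>
  \<open>trajectory S \<alpha> p t \<gamma>\<close>: \<open>\<gamma>\<close> is the piece of trajectory from \<open>p\<close> up to time \<open>t\<close>, which may be
  negative. It does not continue through a conical point, but may have one as an endpoint.
\<close>

definition trajectory ::
    "'q tiled_surface \<Rightarrow> real \<Rightarrow> 'q point \<Rightarrow> real \<Rightarrow> (real \<Rightarrow> 'q point) \<Rightarrow> bool" where
  "trajectory S \<alpha> p t \<gamma> \<longleftrightarrow>
     continuous_path S (closed_segment 0 t) \<gamma> \<and> \<gamma> 0 = p \<and>
     (\<forall>s\<in>closed_segment 0 t. rho (\<gamma> s) = (\<lambda>x. x + s *\<^sub>R direction \<alpha>) ` rho p) \<and>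
     (\<forall>s\<in>open_segment 0 t. \<gamma> s \<notin> conical_points S)"

text \<open>Points from which the forward or the backward trajectory reaches a conical point.\<close>

definition singular_leaves :: "'q tiled_surface \<Rightarrow> real \<Rightarrow> 'q point set" where
  "singular_leaves S \<alpha> =
     {p \<in> points S. \<exists>t \<gamma>. trajectory S \<alpha> p t \<gamma> \<and> \<gamma> t \<in> conical_points S}"

text \<open>
  Outside the singular leaves a trajectory exists for every time \<open>t\<close> and is unique; a value of the
  flow for which this fails is unspecified.
\<close>

definition linear_flow :: "'q tiled_surface \<Rightarrow> real \<Rightarrow> real \<Rightarrow> 'q point \<Rightarrow> 'q point" where
  "linear_flow S \<alpha> t p = (THE q. \<exists>\<gamma>. trajectory S \<alpha> p t \<gamma> \<and> \<gamma> t = q)"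


section \<open>Diophantine type and hitting time\<close>

definition diophantine_type :: "real \<Rightarrow> ereal" where
  "diophantine_type \<alpha> =
     Sup {ereal w | w. w > 0 \<and>
       infinite {(p :: int, q :: int). q > 0 \<and> coprime p q \<and>
         \<bar>\<alpha> - of_int p / of_int q\<bar> < of_int q powr (- (w + 1))}}"

text \<open>An infimum of times over the empty set is \<open>\<infinity>\<close>.\<close>

definition hitting_time :: "'q tiled_surface \<Rightarrow> real \<Rightarrow> 'q point \<Rightarrow> real \<Rightarrow> ereal" where
  "hitting_time X \<alpha> p r =
     (SUP p'\<in>points X. Inf {ereal t | t. t > r \<and> Dist X (linear_flow X \<alpha> t p) p' < r})"

text \<open>
  The logarithm on \<open>(0, \<infinity>]\<close>. Other arguments do not occur, as hitting times at \<open>r > 0\<close> are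
  at least \<open>r\<close>.
\<close>

definition ereal_log :: "ereal \<Rightarrow> ereal" where
  "ereal_log x = (if x = \<infinity> then \<infinity> else ereal (ln (real_of_ereal x)))"

definition hitting_exponent :: "'q tiled_surface \<Rightarrow> real \<Rightarrow> 'q point \<Rightarrow> ereal" where
  "hitting_exponent X \<alpha> p =
     Limsup (at_right 0) (\<lambda>r. ereal_log (hitting_time X \<alpha> p r) / ereal (- ln r))"

end

(*
  Let q alpha - p and q' alpha - p' be the errors of consecutive convergents with q < 2K/r <= q'. The
  matrix in SL(2,Z) with rows (q, -p) and (q', -p') (possibly swapped) stretches a horizontal segment
  of length r/2 next to the target to length at least K, and contracts the flow direction by about
  |q alpha - p|. By hypothesis an orbit piece of length about K / |q alpha - p| then meets the
  horizontal segment, and |q alpha - p| >= c q^(-w) for every w above the type, so the hitting time is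
  O(r^(-w)). Conversely, if |q alpha - p| < q^(-w), the form q x - p y modulo 1 moves so slowly along
  the flow that an orbit needs a time of order q^w to come within about 1/q of a suitable target.
*)
theory Submission
  imports Defs
begin

section \<open>Broken paths and the distance\<close>

text \<open>Both convergents enter one matrix because the hypothesis constrains two slopes at once.
  Since the errors have opposite signs and unequal sizes, the image of the flow direction has
  negative slope different from -1; since \<open>q < q'\<close>, the image of a horizontal vector
  has positive slope different from 1. The sign of the determinant decides which of the two
  alternatives of the hypothesis occurs. The threshold 2K/r is K divided by the length r/2 of the
  horizontal segment. The constant c exists because an exponent w above the type admits only
  finitely many approximations, all with nonzero error. The obstacle is that the flow is specified
  only as the unique endpoint of a trajectory, on a quotient whose distance is an infimum of path
  lengths: existence and uniqueness of trajectories have to be derived from the gluing. Passing from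
  X to A X is cheap by comparison, because A X is described by the same tiles in another
  frame.\<close>

lemma equiv_glue: "equiv (tile_points S) (glue S)"
proof (rule equivI)
  let ?R = "(side_glue S \<union> (side_glue S)\<inverse>)\<^sup>*"
  show "glue S \<subseteq> tile_points S \<times> tile_points S" unfolding glue_def by auto
  show "refl_on (tile_points S) (glue S)"
    unfolding glue_def refl_on_def by auto
  have "sym ?R" by (intro sym_rtrancl sym_Un_converse)
  then show "sym (glue S)" unfolding glue_def sym_def by auto
  show "trans (glue S)"
    unfolding glue_def by (rule transI) (auto intro: rtrancl_trans)
qed

text \<open>Off the tile \<open>glue\<close> relates \<open>(j, x)\<close> to nothing, so the value
  is the empty set. The flow lines built from it below only speak of times at which the argument
  lies in the tile.\<close>

definition point_of :: "'q tiled_surface \<Rightarrow> 'q \<Rightarrow> real^2 \<Rightarrow> 'q point" where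
  "point_of S j x = glue S `` {(j, x)}"

lemma point_of_in_points: "(j, x) \<in> tile_points S \<Longrightarrow> point_of S j x \<in> points S"
  unfolding point_of_def points_def by (rule quotientI)

lemma mem_point_of: "(j, x) \<in> tile_points S \<Longrightarrow> (j, x) \<in> point_of S j x"
  unfolding point_of_def using equiv_class_self[OF equiv_glue] by blast

lemma
  assumes "p \<in> points S" "(j, x) \<in> p"
  shows point_mem_tile_points: "(j, x) \<in> tile_points S"
    and point_eq_point_of: "p = point_of S j x"
proof -
  obtain a where a: "a \<in> tile_points S" "p = glue S `` {a}"
    using assms(1) unfolding points_def by (auto elim: quotientE)
  then have g: "(a, (j, x)) \<in> glue S" using assms(2) by auto
  then show "(j, x) \<in> tile_points S" unfolding glue_def by auto
  show "p = point_of S j x"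
    unfolding point_of_def a(2) using equiv_class_eq[OF equiv_glue g] .
qed

lemma point_nonempty:
  assumes "p \<in> points S"
  obtains j x where "(j, x) \<in> p"
  using assms in_quotient_imp_non_empty[OF equiv_glue] unfolding points_def by fast

lemma point_of_eq_point_of:
  assumes "((i, x), (j, y)) \<in> side_glue S" "(i, x) \<in> tile_points S" "(j, y) \<in> tile_points S"
  shows "point_of S i x = point_of S j y"
  unfolding point_of_def using assms
  by (intro equiv_class_eq[OF equiv_glue]) (auto simp: glue_def)

lemma points_mem_glueI:
  assumes p: "p \<in> points S" "(i, x) \<in> p"
    and g: "((i, x), (j, y)) \<in> side_glue S \<or> ((j, y), (i, x)) \<in> side_glue S"
    and "(j, y) \<in> tile_points S"
  shows "(j, y) \<in> p"
proof -
  have "point_of S i x = point_of S j y"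
    using g point_of_eq_point_of assms(4) point_mem_tile_points[OF p] by metis
  then show ?thesis
    using point_eq_point_of[OF p] mem_point_of[OF assms(4)] by simp
qed

lemma broken_path_points: "broken_path S p q l \<Longrightarrow> p \<in> points S \<and> q \<in> points S"
  by (induction rule: broken_path.induct) auto

lemma broken_path_nonneg: "broken_path S p q l \<Longrightarrow> 0 \<le> l"
  by (induction rule: broken_path.induct) auto

lemma broken_path_step:
  assumes "p \<in> points S" "q \<in> points S" "(j, x) \<in> p" "(j, y) \<in> q"
  shows "broken_path S p q (dist x y)"
  using broken_path.intros(2)[OF broken_path.intros(1)[OF assms(1)] assms(2,3,4)] by simp

text \<open>A path grows at its end, so the induction runs over the second piece, which is therefore
  the first premise.\<close>

lemma broken_path_trans:
  assumes "broken_path S q r m" "broken_path S p q l"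
  shows "broken_path S p r (l + m)"
  using assms
proof (induction rule: broken_path.induct)
  case (2 r m r' j x y)
  then show ?case
    using broken_path.intros(2)[of S p r "l + m" r' j x y] by (simp add: add.assoc)
qed simp

lemma broken_path_sym: "broken_path S p q l \<Longrightarrow> broken_path S q p l"
proof (induction rule: broken_path.induct)
  case (2 q l q' j x y)
  have "broken_path S q' q (dist y x)"
    using 2 broken_path_points by (intro broken_path_step[of _ _ _ j]) auto
  from broken_path_trans[OF 2(5) this] show ?case by (simp add: add.commute dist_commute)
qed (rule broken_path.intros)

lemma Dist_le: "broken_path S p q l \<Longrightarrow> Dist S p q \<le> l"
  unfolding Dist_def
  by (rule cInf_lower) (auto intro!: bdd_belowI[of _ 0] broken_path_nonneg)

lemma Dist_commute: "Dist S p q = Dist S q p"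
proof -
  have "{l. broken_path S p q l} = {l. broken_path S q p l}" by (auto intro: broken_path_sym)
  then show ?thesis unfolding Dist_def by simp
qed

lemma Dist_step_le:
  assumes "p \<in> points S" "q \<in> points S" "(j, x) \<in> p" "(j, y) \<in> q"
  shows "Dist S p q \<le> dist x y"
  using Dist_le[OF broken_path_step[OF assms]] .

text \<open>The infimum of an empty set of reals is unspecified, so \<open>Dist\<close> is
  meaningful only between points that are joined by a path. The notion is kept apart from
  \<open>origami\<close> because it also has to hold on the surfaces \<open>act B S\<close>, whose
  frame need not be the identity.\<close>

definition path_connected_surface :: "'q tiled_surface \<Rightarrow> bool" where
  "path_connected_surface S \<longleftrightarrow> (\<forall>p\<in>points S. \<forall>q\<in>points S. \<exists>l. broken_path S p q l)"

lemma Dist_less_imp_path: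
  assumes "path_connected_surface S" "p \<in> points S" "q \<in> points S" "Dist S p q < e"
  obtains l where "broken_path S p q l" "l < e"
proof -
  have "{l. broken_path S p q l} \<noteq> {}"
    using assms unfolding path_connected_surface_def by auto
  then have "\<exists>l\<in>{l. broken_path S p q l}. l < e"
    using assms(4) unfolding Dist_def by (rule cInf_lessD)
  then show ?thesis using that by auto
qed

lemma Dist_nonneg:
  assumes "path_connected_surface S" "p \<in> points S" "q \<in> points S"
  shows "0 \<le> Dist S p q"
  using assms unfolding Dist_def path_connected_surface_def
  by (intro cInf_greatest) (auto intro: broken_path_nonneg)

lemma Dist_self:
  assumes "path_connected_surface S" "p \<in> points S"
  shows "Dist S p p = 0"
  using Dist_le[OF broken_path.intros(1)[OF assms(2)]] Dist_nonneg[OF assms(1,2,2)] by simp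

lemma Dist_triangle:
  assumes S: "path_connected_surface S" and pq: "p \<in> points S" "q \<in> points S" "r \<in> points S"
  shows "Dist S p r \<le> Dist S p q + Dist S q r"
proof (rule field_le_epsilon)
  fix e :: real assume "e > 0"
  obtain l where l: "broken_path S p q l" "l < Dist S p q + e/2"
    using Dist_less_imp_path[OF S pq(1,2), of "Dist S p q + e/2"] \<open>e > 0\<close> by auto
  obtain m where m: "broken_path S q r m" "m < Dist S q r + e/2"
    using Dist_less_imp_path[OF S pq(2,3), of "Dist S q r + e/2"] \<open>e > 0\<close> by auto
  show "Dist S p r \<le> Dist S p q + Dist S q r + e"
    using Dist_le[OF broken_path_trans[OF m(1) l(1)]] l(2) m(2) by simp
qed

lemma continuous_path_if_Lipschitz:
  assumes S: "path_connected_surface S" and "\<And>t. t \<in> I \<Longrightarrow> \<gamma> t \<in> points S"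
    and lip: "\<And>s t. s \<in> I \<Longrightarrow> t \<in> I \<Longrightarrow> Dist S (\<gamma> s) (\<gamma> t) \<le> C * \<bar>s - t\<bar>"
  shows "continuous_path S I \<gamma>"
proof -
  have "((\<lambda>s. Dist S (\<gamma> s) (\<gamma> t)) \<longlongrightarrow> 0) (at t within I)" if t: "t \<in> I" for t
  proof (rule tendsto_sandwich[of "\<lambda>_. 0" _ _ "\<lambda>s. C * \<bar>s - t\<bar>"])
    have I: "\<forall>\<^sub>F s in at t within I. s \<in> I" by (simp add: eventually_at_filter)
    show "\<forall>\<^sub>F s in at t within I. 0 \<le> Dist S (\<gamma> s) (\<gamma> t)"
      using I by eventually_elim (use assms t in \<open>auto intro: Dist_nonneg\<close>)
    show "\<forall>\<^sub>F s in at t within I. Dist S (\<gamma> s) (\<gamma> t) \<le> C * \<bar>s - t\<bar>"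
      using I by eventually_elim (use assms t in auto)
    have "((\<lambda>s. C * \<bar>s - t\<bar>) \<longlongrightarrow> C * \<bar>t - t\<bar>) (at t within I)"
      by (intro tendsto_intros)
    then show "((\<lambda>s. C * \<bar>s - t\<bar>) \<longlongrightarrow> 0) (at t within I)" by simp
  qed simp
  then show ?thesis unfolding continuous_path_def using assms by auto
qed

lemma continuous_path_subset:
  "continuous_path S I \<gamma> \<Longrightarrow> J \<subseteq> I \<Longrightarrow> continuous_path S J \<gamma>"
  unfolding continuous_path_def using tendsto_within_subset by blast

section \<open>The surface of an origami\<close>

lemma torus_eq_iff: "torus x = torus y \<longleftrightarrow> (\<forall>i. x $ i - y $ i \<in> \<int>)"
proof
  assume "torus x = torus y"
  moreover have "x \<in> torus x"
    unfolding torus_def by (auto intro: exI[of _ 0])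
  ultimately show "\<forall>i. x $ i - y $ i \<in> \<int>" unfolding torus_def by auto
next
  have "torus x \<subseteq> torus y" if xy: "\<forall>i. x $ i - y $ i \<in> \<int>" for x y :: "real^2"
  proof
    fix z assume "z \<in> torus x"
    then obtain n where n: "z = x + n" "\<forall>i. n $ i \<in> \<int>" unfolding torus_def by auto
    then have "z = y + (x - y + n)" "\<forall>i. (x - y + n) $ i \<in> \<int>" using xy by auto
    then show "z \<in> torus y" unfolding torus_def by blast
  qed
  moreover assume "\<forall>i. x $ i - y $ i \<in> \<int>"
  moreover from this have "\<forall>i. y $ i - x $ i \<in> \<int>" by (metis Ints_minus minus_diff_eq)
  ultimately show "torus x = torus y" by blast
qed

lemma translate_torus: "(\<lambda>y. y + v) ` torus x = torus (x + v)"
  unfolding torus_def by (force simp: add_ac)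

lemma mem_torus: "x \<in> torus x"
  unfolding torus_def by (auto intro: exI[of _ 0])

lemma torus_eqI: "y \<in> torus x \<Longrightarrow> torus y = torus x"
  by (auto simp: torus_eq_iff) (auto simp: torus_def)

locale origami_surface =
  fixes X :: "'q tiled_surface"
  assumes origami: "origami X"
begin

lemma
  shows hperm: "hperm X permutes tiles X" and vperm: "vperm X permutes tiles X"
    and frame: "frame X = mat 1"
  using origami unfolding origami_def by auto

lemma tile_points_iff:
  "(j, x) \<in> tile_points X \<longleftrightarrow> j \<in> tiles X \<and> (\<forall>i. 0 \<le> x $ i \<and> x $ i \<le> 1)"
  unfolding tile_points_def frame by (auto simp: mem_box_cart)

lemma side_glue_eq:
  "side_glue X =
     {((j, vector [1, y]), (hperm X j, vector [0, y])) | j y. j \<in> tiles X \<and> 0 \<le> y \<and> y \<le> 1} \<union>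
     {((j, vector [x, 1]), (vperm X j, vector [x, 0])) | j x. j \<in> tiles X \<and> 0 \<le> x \<and> x \<le> 1}"
  unfolding side_glue_def frame by simp

text \<open>A side identification moves the coordinates by a unit vector, hence a chain of them by
  an integer vector. This makes \<open>rho\<close> a single coset that any representative
  computes.\<close>

lemma point_torus_eq:
  assumes "p \<in> points X" "(i, x) \<in> p" "(j, y) \<in> p"
  shows "torus x = torus y"
proof -
  have "(a, b) \<in> (side_glue X \<union> (side_glue X)\<inverse>)\<^sup>* \<Longrightarrow> torus (snd a) = torus (snd b)" for a b
  proof (induction rule: rtrancl_induct)
    case (step b c)
    then have "torus (snd b) = torus (snd c)"
      unfolding side_glue_eq by (auto simp: torus_eq_iff forall_2)
    with step show ?case by simp
  qed simp
  moreover have "((i, x), (j, y)) \<in> glue X"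
    using assms point_eq_point_of[OF assms(1,2)] unfolding point_of_def by auto
  ultimately show ?thesis unfolding glue_def by fastforce
qed

lemma rho_eq: "p \<in> points X \<Longrightarrow> (j, x) \<in> p \<Longrightarrow> rho p = torus x"
  unfolding rho_def using point_torus_eq[of p] by blast

lemma interior_point:
  assumes "p \<in> points X" "(j, x) \<in> p" "\<forall>i. 0 < x $ i \<and> x $ i < 1"
  shows "p = {(j, x)}"
proof -
  have "(a, b) \<in> (side_glue X \<union> (side_glue X)\<inverse>)\<^sup>* \<Longrightarrow> a = (j, x) \<Longrightarrow> b = (j, x)" for a b
  proof (induction rule: rtrancl_induct)
    case (step b c)
    then have "((j, x), c) \<in> side_glue X \<union> (side_glue X)\<inverse>" by simp
    with assms(3) show ?case
      unfolding side_glue_eq by (auto simp: forall_2)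
  qed simp
  moreover have "p = glue X `` {(j, x)}"
    using point_eq_point_of[OF assms(1,2)] unfolding point_of_def .
  ultimately show ?thesis using assms(2) unfolding glue_def by auto
qed

text \<open>Transitivity of the group turns into connectedness: the lower left corner of a tile is
  joined along a side to the lower left corner of its neighbour, and every point to the corner of
  its own tile.\<close>

lemma path_connected: "path_connected_surface X"
proof -
  have tile0: "(j, 0) \<in> tile_points X" if "j \<in> tiles X" for j
    using that by (simp add: tile_points_iff)
  have side: "\<exists>l. broken_path X (point_of X j 0) (point_of X (f j) 0) l"
    if j: "j \<in> tiles X" and f: "f = hperm X \<or> f = vperm X" for j f
  proof -
    \<comment> \<open>The far end of the bottom or left side is the corner that is glued to the
      origin of tile \<open>f j\<close>.\<close>
    define e :: "real^2" where "e = (if f = hperm X then vector [1, 0] else vector [0, 1])"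
    have z: "(0::real^2) = vector [0, 0]" by (simp add: vec_eq_iff forall_2)
    have fj: "f j \<in> tiles X" using j f hperm vperm permutes_in_image by metis
    have e: "(j, e) \<in> tile_points X"
      using j by (auto simp: tile_points_iff e_def forall_2)
    have "((j, e), (f j, 0)) \<in> side_glue X"
      using f j unfolding side_glue_eq e_def z by auto
    then have "point_of X j e = point_of X (f j) 0"
      using point_of_eq_point_of e tile0[OF fj] by metis
    then have "(j, e) \<in> point_of X (f j) 0" using mem_point_of[OF e] by simp
    with broken_path_step[OF point_of_in_points point_of_in_points mem_point_of this] tile0 j fj
    show ?thesis by blast
  qed
  have perm: "g j \<in> tiles X \<and> (\<exists>l. broken_path X (point_of X j 0) (point_of X (g j) 0) l)"
    if "g \<in> generated_perms (hperm X) (vperm X)" "j \<in> tiles X" for g j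
  proof -
    define P where "P k \<longleftrightarrow> k \<in> tiles X \<and> (\<exists>l. broken_path X (point_of X j 0) (point_of X k 0) l)" for k
    have P_trans: "P k'" if "P k" "k' \<in> tiles X" "broken_path X (point_of X k 0) (point_of X k' 0) l" for k k' l
      using that broken_path_trans[OF that(3)] unfolding P_def by blast
    have fwd: "P (f k)" if f: "f = hperm X \<or> f = vperm X" and k: "P k" for f k
    proof -
      have "k \<in> tiles X" using k unfolding P_def by simp
      moreover from this have "f k \<in> tiles X" using f permutes_in_image[OF hperm] permutes_in_image[OF vperm] by auto
      ultimately show ?thesis using side[of k f] f P_trans[OF k] by blast
    qed
    have bwd: "P (inv f k)" if f: "f = hperm X \<or> f = vperm X" and k: "P k" for f k
    proof -
      have f': "f permutes tiles X" using f hperm vperm by auto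
      have "k \<in> tiles X" using k unfolding P_def by simp
      then have 1: "inv f k \<in> tiles X" using permutes_in_image[OF permutes_inv[OF f']] by simp
      moreover have "f (inv f k) = k" using f' by (simp add: permutes_inverses)
      ultimately show ?thesis using side[OF 1 f] P_trans[OF k 1] broken_path_sym by metis
    qed
    have "P (g j)" using that
    proof (induction rule: generated_perms.induct)
      case 1
      then show ?case using broken_path.intros(1)[OF point_of_in_points[OF tile0]] by (auto simp: P_def)
    qed (use fwd bwd in auto)
    then show ?thesis unfolding P_def .
  qed
  show ?thesis unfolding path_connected_surface_def
  proof (intro ballI)
    fix p q assume pq: "p \<in> points X" "q \<in> points X"
    obtain i x j y where ij: "(i, x) \<in> p" "(j, y) \<in> q" using pq point_nonempty by metis
    have t: "i \<in> tiles X" "j \<in> tiles X"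
      using point_mem_tile_points pq ij tile_points_iff by metis+
    then obtain g where "g \<in> generated_perms (hperm X) (vperm X)" "g i = j"
      using origami unfolding origami_def by auto
    then obtain l where "broken_path X (point_of X i 0) (point_of X j 0) l" using perm t by auto
    moreover have "broken_path X p (point_of X i 0) (dist x 0)"
      using t by (intro broken_path_step[OF pq(1) _ ij(1)] point_of_in_points mem_point_of tile0)
    moreover have "broken_path X (point_of X j 0) q (dist 0 y)"
      using t by (intro broken_path_step[OF _ pq(2) _ ij(2)] point_of_in_points mem_point_of tile0)
    ultimately show "\<exists>l. broken_path X p q l" using broken_path_trans by blast
  qed
qed

text \<open>The path is unfolded in the plane: each piece keeps its displacement, and a change of
  representative is an integer translation. So \<open>rho\<close> does not increase distances, which
  is how closeness on the surface enters the lower bound for the hitting time.\<close>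

lemma broken_path_torus:
  assumes "broken_path X p q l" "(i, x) \<in> p" "(j, y) \<in> q"
  shows "\<exists>z \<in> torus y. norm (z - x) \<le> l"
  using assms(1,3)
proof (induction arbitrary: j y rule: broken_path.induct)
  case 1
  then have "torus y = torus x" using point_torus_eq assms(2) by metis
  then show ?case using mem_torus[of x] by auto
next
  case (2 q l q' k a b)
  then obtain z where z: "z \<in> torus a" "norm (z - x) \<le> l" by blast
  have "torus b = torus y" using 2 point_torus_eq by metis
  then have "b - a + z \<in> torus y"
    using z(1) by (auto simp: torus_def add.assoc[symmetric])
  moreover have "norm (b - a + z - x) \<le> l + dist a b"
    using norm_triangle_ineq[of "z - x" "b - a"] z(2)
    by (simp add: dist_norm norm_minus_commute algebra_simps)
  ultimately show ?case by blast
qed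

text \<open>A path can change tiles only at a boundary point, and every side is at distance at least
  \<open>e\<close> from \<open>x\<close>.\<close>

lemma interior_ball:
  assumes x: "\<forall>i. e \<le> x $ i \<and> x $ i \<le> 1 - e" and "broken_path X p q l" "p = {(j, x)}" "l < e"
  shows "\<exists>y. q = {(j, y)} \<and> norm (y - x) \<le> l"
  using assms(2-)
proof (induction rule: broken_path.induct)
  case (2 q l q' k a b)
  have "l < e" using 2(7) zero_le_dist[of a b] by linarith
  then obtain y where "q = {(j, y)}" "norm (y - x) \<le> l" using 2(5)[OF 2(6)] by auto
  then have k: "k = j" "norm (a - x) \<le> l" using 2(3) by auto
  have b: "norm (b - x) \<le> l + dist a b"
    using norm_triangle_ineq[of "a - x" "b - a"] k(2)
    by (simp add: dist_norm norm_minus_commute algebra_simps)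
  have "0 < b $ i \<and> b $ i < 1" for i
  proof -
    have "\<bar>b $ i - x $ i\<bar> < e"
      using component_le_norm_cart[of "b - x" i] b 2(7) by simp
    then show ?thesis using x[rule_format, of i] by auto
  qed
  then have "q' = {(j, b)}" using interior_point[of q' j b] 2(2,4) k by auto
  then show ?case using b by auto
qed auto

text \<open>A small ball lies in one open tile, where \<open>rho\<close> is the projection of the
  open unit square to the torus: coordinates in (0,1) that differ by an integer agree.\<close>

lemma interior_nonconical:
  assumes p: "p \<in> points X" "(j, x) \<in> p" and x: "\<forall>i. 0 < x $ i \<and> x $ i < 1"
  shows "p \<notin> conical_points X"
proof -
  have pe: "p = {(j, x)}" using interior_point[OF p x] .
  \<comment> \<open>The distance from \<open>x\<close> to the nearest side.\<close>
  define e where "e = Min (range (\<lambda>i. min (x $ i) (1 - x $ i)))"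
  have "e > 0" unfolding e_def using x by (subst Min_gr_iff) auto
  have "e \<le> min (x $ i) (1 - x $ i)" for i unfolding e_def by (rule Min_le) auto
  then have e: "\<forall>i. e \<le> x $ i \<and> x $ i \<le> 1 - e" by (auto simp: algebra_simps)
  have "\<exists>y. q = {(j, y)} \<and> (\<forall>i. 0 < y $ i \<and> y $ i < 1)" if q: "q \<in> points X" "Dist X p q < e" for q
  proof -
    obtain l where l: "broken_path X p q l" "l < e"
      using Dist_less_imp_path[OF path_connected p(1) q] by blast
    then obtain y where y: "q = {(j, y)}" "norm (y - x) \<le> l" using interior_ball[OF e l(1) pe] by auto
    have "0 < y $ i \<and> y $ i < 1" for i
    proof -
      have "\<bar>y $ i - x $ i\<bar> < e"
        using component_le_norm_cart[of "y - x" i] y l by simp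
      then show ?thesis using e[rule_format, of i] by auto
    qed
    then show ?thesis using y by auto
  qed
  note ball = this
  have "inj_on rho {q \<in> points X. Dist X p q < e}"
  proof (rule inj_onI)
    fix q q' assume q: "q \<in> {q \<in> points X. Dist X p q < e}" "q' \<in> {q \<in> points X. Dist X p q < e}"
      and r: "rho q = rho q'"
    obtain y where y: "q = {(j, y)}" "\<forall>i. 0 < y $ i \<and> y $ i < 1" using ball q by blast
    obtain y' where y': "q' = {(j, y')}" "\<forall>i. 0 < y' $ i \<and> y' $ i < 1" using ball q by blast
    have "torus y = torus y'" using r y y' by (simp add: rho_def)
    then have "y $ i - y' $ i \<in> \<int>" for i by (auto simp: torus_eq_iff)
    moreover have "\<bar>y $ i - y' $ i\<bar> < 1" for i
      using y(2)[rule_format, of i] y'(2)[rule_format, of i] by auto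
    ultimately have "y $ i = y' $ i" for i using Ints_nonzero_abs_less1 by fastforce
    then show "q = q'" using y y' by (simp add: vec_eq_iff)
  qed
  with \<open>e > 0\<close> show ?thesis unfolding conical_points_def by auto
qed

end

section \<open>Existence and uniqueness of flow lines\<close>

text \<open>Distance from \<open>x\<close> to the side of the unit square towards which coordinate \<open>i\<close> moves.\<close>

definition exit_dist :: "real^2 \<Rightarrow> real^2 \<Rightarrow> 2 \<Rightarrow> real" where
  "exit_dist u x i = (if u $ i > 0 then 1 - x $ i else x $ i)"

context origami_surface
begin

text \<open>A point on a side lies in several tiles; the representative chosen is in a tile that a
  line with velocity \<open>u\<close> enters. Each coordinate is corrected by one crossing that
  leaves the other alone, so a corner takes one of each kind. At a conical point this picks one of
  several possible tiles.\<close>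

lemma entry_representative:
  assumes p: "p \<in> points X" "(j, y) \<in> p"
  obtains k z where "(k, z) \<in> p"
    "\<And>i. exit_dist u z i = (if exit_dist u y i = 0 then 1 else exit_dist u y i)"
proof -
  have 1: "\<exists>k z. (k, z) \<in> p \<and> z $ 2 = y $ 2 \<and>
      exit_dist u z 1 = (if exit_dist u y 1 = 0 then 1 else exit_dist u y 1)"
    if "(j, y) \<in> p" for j y
  proof (cases "exit_dist u y 1 = 0")
    case True
    have y: "j \<in> tiles X" "0 \<le> y $ 2" "y $ 2 \<le> 1"
      using point_mem_tile_points[OF p(1) that] by (auto simp: tile_points_iff)
    show ?thesis
    proof (cases "u $ 1 > 0")
      case u: True
      then have "y = vector [1, y $ 2]" using True by (simp add: exit_dist_def vec_eq_iff forall_2)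
      then have "((j, y), (hperm X j, vector [0, y $ 2])) \<in> side_glue X"
        unfolding side_glue_eq using y by fastforce
      then have "(hperm X j, vector [0, y $ 2]) \<in> p"
        using y permutes_in_image[OF hperm]
        by (intro points_mem_glueI[OF p(1) that]) (auto simp: tile_points_iff forall_2)
      then show ?thesis using u True 
        by (intro exI[of _ "hperm X j"] exI[of _ "vector [0, y $ 2]"]) (auto simp: exit_dist_def)
    next
      case u: False
      have k: "hperm X (inv (hperm X) j) = j" "inv (hperm X) j \<in> tiles X"
        using y permutes_inverses[OF hperm] permutes_in_image[OF permutes_inv[OF hperm]] by auto
      have "y = vector [0, y $ 2]" using u True by (simp add: exit_dist_def vec_eq_iff forall_2)
      then have "((inv (hperm X) j, vector [1, y $ 2]), (j, y)) \<in> side_glue X"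
        unfolding side_glue_eq using y k by fastforce
      then have "(inv (hperm X) j, vector [1, y $ 2]) \<in> p"
        using y k by (intro points_mem_glueI[OF p(1) that]) (auto simp: tile_points_iff forall_2)
      then show ?thesis using u True 
        by (intro exI[of _ "inv (hperm X) j"] exI[of _ "vector [1, y $ 2]"]) (auto simp: exit_dist_def)
    qed
  qed (use that in auto)
  have 2: "\<exists>k z. (k, z) \<in> p \<and> z $ 1 = y $ 1 \<and>
      exit_dist u z 2 = (if exit_dist u y 2 = 0 then 1 else exit_dist u y 2)"
    if "(j, y) \<in> p" for j y
  proof (cases "exit_dist u y 2 = 0")
    case True
    have y: "j \<in> tiles X" "0 \<le> y $ 1" "y $ 1 \<le> 1"
      using point_mem_tile_points[OF p(1) that] by (auto simp: tile_points_iff)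
    show ?thesis
    proof (cases "u $ 2 > 0")
      case u: True
      then have "y = vector [y $ 1, 1]" using True by (simp add: exit_dist_def vec_eq_iff forall_2)
      then have "((j, y), (vperm X j, vector [y $ 1, 0])) \<in> side_glue X"
        unfolding side_glue_eq using y by fastforce
      then have "(vperm X j, vector [y $ 1, 0]) \<in> p"
        using y permutes_in_image[OF vperm]
        by (intro points_mem_glueI[OF p(1) that]) (auto simp: tile_points_iff forall_2)
      then show ?thesis using u True 
        by (intro exI[of _ "vperm X j"] exI[of _ "vector [y $ 1, 0]"]) (auto simp: exit_dist_def)
    next
      case u: False
      have k: "vperm X (inv (vperm X) j) = j" "inv (vperm X) j \<in> tiles X"
        using y permutes_inverses[OF vperm] permutes_in_image[OF permutes_inv[OF vperm]] by auto
      have "y = vector [y $ 1, 0]" using u True by (simp add: exit_dist_def vec_eq_iff forall_2)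
      then have "((inv (vperm X) j, vector [y $ 1, 1]), (j, y)) \<in> side_glue X"
        unfolding side_glue_eq using y k by fastforce
      then have "(inv (vperm X) j, vector [y $ 1, 1]) \<in> p"
        using y k by (intro points_mem_glueI[OF p(1) that]) (auto simp: tile_points_iff forall_2)
      then show ?thesis using u True 
        by (intro exI[of _ "inv (vperm X) j"] exI[of _ "vector [y $ 1, 1]"]) (auto simp: exit_dist_def)
    qed
  qed (use that in auto)
  obtain k z where k: "(k, z) \<in> p" "z $ 2 = y $ 2"
      "exit_dist u z 1 = (if exit_dist u y 1 = 0 then 1 else exit_dist u y 1)"
    using 1[OF p(2)] by blast
  obtain k' z' where k': "(k', z') \<in> p" "z' $ 1 = z $ 1"
      "exit_dist u z' 2 = (if exit_dist u z 2 = 0 then 1 else exit_dist u z 2)"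
    using 2[OF k(1)] by blast
  have c: "exit_dist u z' 1 = exit_dist u z 1" "exit_dist u z 2 = exit_dist u y 2"
    using k k' by (auto simp: exit_dist_def)
  have "exit_dist u z' i = (if exit_dist u y i = 0 then 1 else exit_dist u y i)" for i
    using exhaust_2[of i] k(3) k'(3) c by auto
  with k'(1) show ?thesis by (rule that)
qed

text \<open>A forward trajectory with a Lipschitz bound in place of continuity, so that
  concatenation only needs the triangle inequality. The velocity is arbitrary in order to cover
  horizontal lines as well as the flow.\<close>

definition flow_line :: "real^2 \<Rightarrow> 'q point \<Rightarrow> real \<Rightarrow> (real \<Rightarrow> 'q point) \<Rightarrow> bool" where
  "flow_line u p t \<gamma> \<longleftrightarrow>
     \<gamma> 0 = p \<and>
     (\<forall>s\<in>{0..t}. \<gamma> s \<in> points X \<and> rho (\<gamma> s) = (\<lambda>x. x + s *\<^sub>R u) ` rho p) \<and>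
     (\<forall>s\<in>{0<..<t}. \<gamma> s \<notin> conical_points X) \<and>
     (\<forall>s\<in>{0..t}. \<forall>s'\<in>{0..t}. Dist X (\<gamma> s) (\<gamma> s') \<le> norm u * \<bar>s - s'\<bar>)"

lemma
  assumes "flow_line u p t \<gamma>"
  shows flow_line_0: "\<gamma> 0 = p"
    and flow_line_point: "0 \<le> s \<Longrightarrow> s \<le> t \<Longrightarrow> \<gamma> s \<in> points X"
    and flow_line_rho: "0 \<le> s \<Longrightarrow> s \<le> t \<Longrightarrow> rho (\<gamma> s) = (\<lambda>x. x + s *\<^sub>R u) ` rho p"
    and flow_line_nonconical: "0 < s \<Longrightarrow> s < t \<Longrightarrow> \<gamma> s \<notin> conical_points X"
    and flow_line_Dist: "0 \<le> a \<Longrightarrow> a \<le> t \<Longrightarrow> 0 \<le> b \<Longrightarrow> b \<le> t \<Longrightarrow>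
      Dist X (\<gamma> a) (\<gamma> b) \<le> norm u * \<bar>a - b\<bar>"
  using assms unfolding flow_line_def by simp_all

text \<open>The junction becomes an interior time of the longer line, hence must not be conical.
  Across it the two Lipschitz bounds add up, because both have the same constant.\<close>

lemma flow_line_append:
  assumes g: "flow_line u p s \<gamma>" and g': "flow_line u (\<gamma> s) t \<gamma>'"
    and "\<gamma> s \<notin> conical_points X" and st: "0 \<le> s" "0 \<le> t"
  shows "flow_line u p (s + t) (\<lambda>\<tau>. if \<tau> \<le> s then \<gamma> \<tau> else \<gamma>' (\<tau> - s))"
    (is "flow_line u p (s + t) ?g")
proof -
  have L: "Dist X (\<gamma> a) (\<gamma> b) \<le> norm u * (b - a)" if "0 \<le> a" "a \<le> b" "b \<le> s" for a b
    using flow_line_Dist[OF g, of a b] that by simp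
  have L': "Dist X (\<gamma>' a) (\<gamma>' b) \<le> norm u * (b - a)" if "0 \<le> a" "a \<le> b" "b \<le> t" for a b
    using flow_line_Dist[OF g', of a b] that by simp
  have P: "\<gamma> a \<in> points X" if "0 \<le> a" "a \<le> s" for a
    using g that unfolding flow_line_def by auto
  have P': "\<gamma>' a \<in> points X" if "0 \<le> a" "a \<le> t" for a
    using g' that unfolding flow_line_def by auto
  have 0: "\<gamma>' 0 = \<gamma> s" using g' unfolding flow_line_def by simp
  have lip: "Dist X (?g \<tau>) (?g \<tau>') \<le> norm u * (\<tau>' - \<tau>)" if "0 \<le> \<tau>" "\<tau> \<le> \<tau>'" "\<tau>' \<le> s + t" for \<tau> \<tau>'
  proof -
    consider "\<tau>' \<le> s" | "s < \<tau>" | "\<tau> \<le> s" "s < \<tau>'" by linarith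
    then show ?thesis
    proof cases
      case 1
      then show ?thesis using L[of \<tau> \<tau>'] that by simp
    next
      case 2
      then show ?thesis using L'[of "\<tau> - s" "\<tau>' - s"] that by simp
    next
      case 3
      have "Dist X (\<gamma> \<tau>) (\<gamma>' (\<tau>' - s)) \<le> Dist X (\<gamma> \<tau>) (\<gamma> s) + Dist X (\<gamma> s) (\<gamma>' (\<tau>' - s))"
        using 3 st that by (intro Dist_triangle[OF path_connected] P P') auto
      also have "\<dots> \<le> norm u * (s - \<tau>) + norm u * (\<tau>' - s - 0)"
        using 3 st that L[of \<tau> s] L'[of 0 "\<tau>' - s"] by (intro add_mono) (auto simp: 0)
      also have "\<dots> = norm u * (\<tau>' - \<tau>)" by (simp add: algebra_simps)
      finally show ?thesis using 3 by simp
    qed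
  qed
  have lip': "Dist X (?g \<tau>) (?g \<tau>') \<le> norm u * \<bar>\<tau> - \<tau>'\<bar>" if "\<tau> \<in> {0..s + t}" "\<tau>' \<in> {0..s + t}" for \<tau> \<tau>'
  proof (cases "\<tau> \<le> \<tau>'")
    case True
    then show ?thesis using lip[of \<tau> \<tau>'] that by simp
  next
    case False
    then show ?thesis using lip[of \<tau>' \<tau>] that Dist_commute[of X "?g \<tau>" "?g \<tau>'"] by simp
  qed
  have val: "?g \<tau> \<in> points X \<and> rho (?g \<tau>) = (\<lambda>x. x + \<tau> *\<^sub>R u) ` rho p" if \<tau>: "\<tau> \<in> {0..s + t}" for \<tau>
  proof (cases "\<tau> \<le> s")
    case False
    have "rho (\<gamma>' (\<tau> - s)) = (\<lambda>x. x + (\<tau> - s) *\<^sub>R u) ` (\<lambda>x. x + s *\<^sub>R u) ` rho p"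
      using g g' False \<tau> st unfolding flow_line_def by auto
    also have "\<dots> = (\<lambda>x. x + \<tau> *\<^sub>R u) ` rho p"
      by (simp add: image_image algebra_simps)
    finally show ?thesis using False g' \<tau> by (auto simp: flow_line_def)
  qed (use g \<tau> in \<open>auto simp: flow_line_def\<close>)
  have nc: "?g \<tau> \<notin> conical_points X" if \<tau>: "\<tau> \<in> {0<..<s + t}" for \<tau>
  proof -
    consider "\<tau> < s" | "\<tau> = s" | "s < \<tau>" by linarith
    then show ?thesis by cases (use g g' assms(3) \<tau> in \<open>auto simp: flow_line_def\<close>)
  qed
  show ?thesis unfolding flow_line_def
    using val nc lip' g st by (auto simp: flow_line_def)
qed

text \<open>Only the open piece has to avoid the sides; an endpoint on the boundary is where the
  next tile takes over.\<close>

lemma flow_line_in_tile: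
  assumes p: "p \<in> points X" "(j, x) \<in> p"
    and closed: "\<And>s i. 0 \<le> s \<Longrightarrow> s \<le> t \<Longrightarrow> 0 \<le> (x + s *\<^sub>R u) $ i \<and> (x + s *\<^sub>R u) $ i \<le> 1"
    and int: "\<And>s i. 0 < s \<Longrightarrow> s < t \<Longrightarrow> 0 < (x + s *\<^sub>R u) $ i \<and> (x + s *\<^sub>R u) $ i < 1"
  shows "flow_line u p t (\<lambda>s. point_of X j (x + s *\<^sub>R u))"
proof -
  let ?g = "\<lambda>s. point_of X j (x + s *\<^sub>R u)"
  have j: "j \<in> tiles X" using point_mem_tile_points[OF p] by (simp add: tile_points_iff)
  have tp: "(j, x + s *\<^sub>R u) \<in> tile_points X" if "0 \<le> s" "s \<le> t" for s
    using closed[OF that] j by (simp add: tile_points_iff)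
  have P: "?g s \<in> points X" "(j, x + s *\<^sub>R u) \<in> ?g s" if "0 \<le> s" "s \<le> t" for s
    using point_of_in_points[OF tp] mem_point_of[OF tp] that by blast+
  have "?g 0 = p" using point_eq_point_of[OF p] by simp
  moreover have "rho (?g s) = (\<lambda>x. x + s *\<^sub>R u) ` rho p" if "0 \<le> s" "s \<le> t" for s
    using rho_eq[OF P[OF that]] rho_eq[OF p] by (simp add: translate_torus)
  moreover have "?g s \<notin> conical_points X" if "0 < s" "s < t" for s
    using P[of s] int[OF that] that by (intro interior_nonconical[of _ j "x + s *\<^sub>R u"]) auto
  moreover have "Dist X (?g s) (?g s') \<le> norm u * \<bar>s - s'\<bar>"
    if "0 \<le> s" "s \<le> t" "0 \<le> s'" "s' \<le> t" for s s'
  proof -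
    have "Dist X (?g s) (?g s') \<le> dist (x + s *\<^sub>R u) (x + s' *\<^sub>R u)"
      using that by (intro Dist_step_le[of _ _ _ j] P)
    also have "\<dots> = norm ((s - s') *\<^sub>R u)" by (simp add: dist_norm scaleR_left_diff_distrib)
    finally show ?thesis by (simp add: mult.commute)
  qed
  ultimately show ?thesis unfolding flow_line_def using P by auto
qed

lemma exit_dist_move: "exit_dist u (x + s *\<^sub>R u) i = exit_dist u x i - s * \<bar>u $ i\<bar>"
  by (auto simp: exit_dist_def)

lemma exit_dist_unit:
  "0 \<le> x $ i \<and> x $ i \<le> 1 \<longleftrightarrow> 0 \<le> exit_dist u x i \<and> exit_dist u x i \<le> 1"
  "0 < x $ i \<and> x $ i < 1 \<longleftrightarrow> 0 < exit_dist u x i \<and> exit_dist u x i < 1"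
  by (auto simp: exit_dist_def)

text \<open>
  The induction is on the number of sides that a line with velocity \<open>u\<close> crosses up to time \<open>t\<close>: each
  crossing raises \<open>exit_dist\<close> from \<open>0\<close> to \<open>1\<close> in some coordinate, and
  \<open>t * \<bar>u $ i\<bar> - exit_dist u x i\<close> is otherwise constant along the line.
\<close>

lemma flow_line_exists_aux:
  assumes u: "\<And>i. u $ i \<noteq> 0"
    and "p \<in> points X" "(j, x) \<in> p" "\<And>i. 0 < exit_dist u x i" "0 \<le> t"
    and "t * \<bar>u $ 1\<bar> - exit_dist u x 1 + (t * \<bar>u $ 2\<bar> - exit_dist u x 2) < real n - 2"
  shows "\<exists>s \<gamma>. 0 \<le> s \<and> s \<le> t \<and> flow_line u p s \<gamma> \<and> (s = t \<or> \<gamma> s \<in> conical_points X)"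
  using assms(2-)
proof (induction n arbitrary: p j x t)
  \<comment> \<open>Both exit distances are at most 1, so the sum that is bounded is at least -2.
    The shift by 2 makes this case contradictory.\<close>
  case 0
  have "exit_dist u x i \<le> 1" for i
    using point_mem_tile_points[OF 0(1,2)] exit_dist_unit(1)[of x i u] tile_points_iff by blast
  from this[of 1] this[of 2] have "0 \<le> t * \<bar>u $ 1\<bar>" "0 \<le> t * \<bar>u $ 2\<bar>"
      "exit_dist u x 1 \<le> 1" "exit_dist u x 2 \<le> 1" using 0(4) by auto
  with 0(5) show ?case by linarith
next
  case (Suc n)
  note p = Suc.prems(1,2) and d0 = Suc.prems(3) and t = Suc.prems(4)
  have d1: "exit_dist u x i \<le> 1" for i
    using point_mem_tile_points[OF p] exit_dist_unit(1)[of x i u] tile_points_iff by blast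
  \<comment> \<open>The first time at which the line reaches a side.\<close>
  define \<tau> where "\<tau> = min (exit_dist u x 1 / \<bar>u $ 1\<bar>) (exit_dist u x 2 / \<bar>u $ 2\<bar>)"
  have u0: "\<bar>u $ i\<bar> > 0" for i using u by simp
  have \<tau>0: "\<tau> > 0" unfolding \<tau>_def using d0 u0 by (simp add: u)
  have "\<tau> * \<bar>u $ 1\<bar> \<le> exit_dist u x 1" "\<tau> * \<bar>u $ 2\<bar> \<le> exit_dist u x 2"
    using u0 by (simp_all add: pos_le_divide_eq[symmetric] \<tau>_def)
  then have \<tau>: "\<tau> * \<bar>u $ i\<bar> \<le> exit_dist u x i" for i using exhaust_2[of i] by auto
  have \<tau>_eq: "\<tau> * \<bar>u $ 1\<bar> = exit_dist u x 1 \<or> \<tau> * \<bar>u $ 2\<bar> = exit_dist u x 2"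
    unfolding \<tau>_def min_def using u by simp
  have le: "s * \<bar>u $ i\<bar> \<le> exit_dist u x i" if "s \<le> \<tau>" for s i
    using mult_right_mono[OF that, of "\<bar>u $ i\<bar>"] \<tau>[of i] by simp
  have less: "s * \<bar>u $ i\<bar> < exit_dist u x i" if "s < \<tau>" for s i
    using mult_strict_right_mono[OF that u0[of i]] \<tau>[of i] by simp
  have line: "flow_line u p s (\<lambda>s. point_of X j (x + s *\<^sub>R u))" if "s \<le> \<tau>" for s
  proof (rule flow_line_in_tile[OF p])
    fix s' i assume s': "0 \<le> s'" "s' \<le> s"
    then have "s' * \<bar>u $ i\<bar> \<le> exit_dist u x i" using le that by simp
    moreover have "0 \<le> s' * \<bar>u $ i\<bar>" using s' by simp
    ultimately show "0 \<le> (x + s' *\<^sub>R u) $ i \<and> (x + s' *\<^sub>R u) $ i \<le> 1"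
      unfolding exit_dist_unit(1)[of _ i u] exit_dist_move
      using d1[of i] by linarith
  next
    fix s' i assume s': "0 < s'" "s' < s"
    then show "0 < (x + s' *\<^sub>R u) $ i \<and> (x + s' *\<^sub>R u) $ i < 1"
      unfolding exit_dist_unit(2)[of _ i u] exit_dist_move
      using less[of s' i] that d1[of i] mult_pos_pos[OF s'(1) u0[of i]] by linarith
  qed
  show ?case
  proof (cases "t \<le> \<tau>")
    case True
    then show ?thesis using line t by blast
  next
    case False
    let ?g = "\<lambda>s. point_of X j (x + s *\<^sub>R u)"
    define y where "y = x + \<tau> *\<^sub>R u"
    have g: "flow_line u p \<tau> ?g" using line by simp
    have q: "?g \<tau> \<in> points X" using flow_line_point[OF g, of \<tau>] \<tau>0 by simp
    have "0 \<le> \<tau> * \<bar>u $ i\<bar>" for i using \<tau>0 by simp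
    then have "0 \<le> y $ i \<and> y $ i \<le> 1" for i
      unfolding y_def exit_dist_unit(1)[of _ i u] exit_dist_move
      using \<tau>[of i] d1[of i] by (smt (verit))
    then have "(j, y) \<in> tile_points X"
      using point_mem_tile_points[OF p] by (simp add: tile_points_iff)
    then have yq: "(j, y) \<in> ?g \<tau>" using mem_point_of unfolding y_def by fast
    show ?thesis
    proof (cases "?g \<tau> \<in> conical_points X")
      case True
      then show ?thesis using g False \<tau>0 by (intro exI[of _ \<tau>] exI[of _ ?g]) auto
    next
      case nc: False
      obtain k z where kz: "(k, z) \<in> ?g \<tau>"
        "\<And>i. exit_dist u z i = (if exit_dist u y i = 0 then 1 else exit_dist u y i)"
        using entry_representative[OF q yq, of u] by blast
      have dy: "exit_dist u y i = exit_dist u x i - \<tau> * \<bar>u $ i\<bar>" for i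
        unfolding y_def by (rule exit_dist_move)
      have "0 < exit_dist u z i" for i using kz(2)[of i] dy[of i] \<tau>[of i] by simp
      moreover have "(t - \<tau>) * \<bar>u $ 1\<bar> - exit_dist u z 1 + ((t - \<tau>) * \<bar>u $ 2\<bar> - exit_dist u z 2)
          < real n - 2"
        using \<tau>_eq kz(2)[of 1] kz(2)[of 2] dy[of 1] dy[of 2] \<tau>[of 1] \<tau>[of 2] Suc.prems(5)
        by (auto simp: left_diff_distrib split: if_splits)
      ultimately obtain s \<gamma> where s: "0 \<le> s" "s \<le> t - \<tau>" "flow_line u (?g \<tau>) s \<gamma>"
          "s = t - \<tau> \<or> \<gamma> s \<in> conical_points X"
        using Suc.IH[OF q kz(1), of "t - \<tau>"] False by auto
      let ?h = "\<lambda>\<sigma>. if \<sigma> \<le> \<tau> then ?g \<sigma> else \<gamma> (\<sigma> - \<tau>)"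
      have "flow_line u p (\<tau> + s) ?h"
        using flow_line_append[OF g s(3) nc] \<tau>0 s(1) by simp
      moreover have "\<tau> + s = t \<or> ?h (\<tau> + s) \<in> conical_points X"
        using s(4) flow_line_0[OF s(3)] s(1) by (cases "s = 0") auto
      ultimately show ?thesis
        using s \<tau>0 by (intro exI[of _ "\<tau> + s"] exI[of _ ?h]) auto
    qed
  qed
qed

lemma flow_line_exists:
  assumes u: "\<And>i. u $ i \<noteq> 0" and p: "p \<in> points X" and t: "0 \<le> t"
  obtains s \<gamma> where "0 \<le> s" "s \<le> t" "flow_line u p s \<gamma>" "s = t \<or> \<gamma> s \<in> conical_points X"
proof -
  obtain j y where y: "(j, y) \<in> p" using point_nonempty[OF p] .
  have "0 \<le> exit_dist u y i" for i
    using point_mem_tile_points[OF p y] exit_dist_unit(1)[of y i u] tile_points_iff by blast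
  moreover obtain k z where kz: "(k, z) \<in> p"
      "\<And>i. exit_dist u z i = (if exit_dist u y i = 0 then 1 else exit_dist u y i)"
    using entry_representative[OF p y, of u] by blast
  ultimately have "0 < exit_dist u z i" for i using kz(2)[of i] by (auto simp: order_less_le)
  moreover obtain n where
    "t * \<bar>u $ 1\<bar> - exit_dist u z 1 + (t * \<bar>u $ 2\<bar> - exit_dist u z 2) + 2 < real n"
    using reals_Archimedean2 by blast
  ultimately show ?thesis
    using flow_line_exists_aux[OF u p kz(1) _ t, of n] that by force
qed

text \<open>The set of times at which the two lifts agree is open and closed in the interval: near a
  nonconical point \<open>rho\<close> is injective, so lifts that are close to each other and have
  the same image coincide.\<close>

lemma lift_unique:
  assumes g: "continuous_path X {0..t} \<gamma>" and g': "continuous_path X {0..t} \<gamma>'"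
    and 0: "\<gamma> 0 = \<gamma>' 0" "0 \<le> t"
    and rho: "\<And>s. s \<in> {0..t} \<Longrightarrow> rho (\<gamma> s) = rho (\<gamma>' s)"
    and nc: "\<And>s. s \<in> {0..t} \<Longrightarrow> \<gamma> s \<notin> conical_points X"
  shows "\<gamma> t = \<gamma>' t"
proof (rule connected_induction_simple[of "{0..t}" 0 t "\<lambda>s. \<gamma> s = \<gamma>' s"])
  fix s0 assume s0: "s0 \<in> {0..t}"
  have P: "\<gamma> s \<in> points X" "\<gamma>' s \<in> points X" if "s \<in> {0..t}" for s
    using g g' that unfolding continuous_path_def by auto
  note tri = Dist_triangle[OF path_connected]
  obtain e where e: "e > 0" "inj_on rho {q \<in> points X. Dist X (\<gamma> s0) q < e}"
    using nc[OF s0] P[OF s0] unfolding conical_points_def by auto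
  let ?D = "Dist X (\<gamma> s0) (\<gamma>' s0)"
  \<comment> \<open>If \<open>?D\<close> is 0, both paths stay for a while in the ball where
    \<open>rho\<close> is injective, hence agree there. Otherwise each moves by less than half the
    gap, so they cannot meet.\<close>
  define d where "d = (if ?D = 0 then e else ?D / 2)"
  have d: "d > 0" unfolding d_def using e(1) Dist_nonneg[OF path_connected P[OF s0]] by simp
  have "\<forall>\<^sub>F s in at s0 within {0..t}. Dist X (\<gamma> s) (\<gamma> s0) < d \<and> Dist X (\<gamma>' s) (\<gamma>' s0) < d"
    using g g' s0 d unfolding continuous_path_def
    by (intro eventually_conj order_tendstoD(2)[of _ 0]) auto
  then obtain r where r: "r > 0" "\<And>s. s \<in> {0..t} \<Longrightarrow> s \<noteq> s0 \<Longrightarrow> dist s s0 < r \<Longrightarrow>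
      Dist X (\<gamma> s) (\<gamma> s0) < d \<and> Dist X (\<gamma>' s) (\<gamma>' s0) < d"
    unfolding eventually_at by auto
  define T where "T = {0..t} \<inter> ball s0 r"
  have near: "Dist X (\<gamma> s) (\<gamma> s0) < d" "Dist X (\<gamma>' s) (\<gamma>' s0) < d" if "s \<in> T" for s
    using r(2)[of s] that d Dist_self[OF path_connected] P[OF s0]
    unfolding T_def by (cases "s = s0"; auto simp: dist_commute)+
  have "(\<gamma> s = \<gamma>' s) \<longleftrightarrow> ?D = 0" if s: "s \<in> T" for s
  proof
    have st: "s \<in> {0..t}" using s unfolding T_def by simp
    { assume D: "?D = 0"
      then have "Dist X (\<gamma> s0) (\<gamma>' s) < e" "Dist X (\<gamma> s0) (\<gamma> s) < e"
        using near[OF s] tri[OF P(1)[OF s0] P(2)[OF s0] P(2)[OF st]] d_def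
          Dist_commute[of X "\<gamma>' s"] Dist_commute[of X "\<gamma> s"] by auto
      then show "\<gamma> s = \<gamma>' s"
        using inj_onD[OF e(2) rho[OF st]] P[OF st] by simp }
    { assume eq: "\<gamma> s = \<gamma>' s"
      have "?D \<le> Dist X (\<gamma> s0) (\<gamma> s) + Dist X (\<gamma>' s) (\<gamma>' s0)"
        using tri[OF P(1)[OF s0] P(1)[OF st] P(2)[OF s0]] eq by simp
      then have "?D < d + d"
        using near[OF s] Dist_commute[of X "\<gamma> s"] by simp
      then show "?D = 0" unfolding d_def by (auto split: if_splits) }
  qed
  moreover have "openin (top_of_set {0..t}) T" unfolding T_def by (simp add: openin_open_Int)
  moreover have "s0 \<in> T" using s0 r unfolding T_def by simp
  ultimately show "\<exists>T. openin (top_of_set {0..t}) T \<and> s0 \<in> T \<and>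
      (\<forall>x\<in>T. \<forall>y\<in>T. \<gamma> x = \<gamma>' x \<longrightarrow> \<gamma> y = \<gamma>' y)" by metis
qed (use 0 in auto)

section \<open>The flow outside the singular leaves\<close>

lemma trajectory_restrict:
  assumes "trajectory S \<alpha> p t \<gamma>" "0 \<le> s" "s \<le> t"
  shows "trajectory S \<alpha> p s \<gamma>"
  using assms unfolding trajectory_def
  by (auto simp: closed_segment_eq_real_ivl open_segment_eq_real_ivl intro: continuous_path_subset)

lemma flow_line_imp_trajectory:
  assumes "flow_line (direction \<alpha>) p t \<gamma>" "0 \<le> t"
  shows "trajectory X \<alpha> p t \<gamma>"
proof -
  note g = assms(1)
  have "continuous_path X {0..t} \<gamma>"
    using flow_line_point[OF g] flow_line_Dist[OF g]
    by (intro continuous_path_if_Lipschitz[OF path_connected, of _ _ "norm (direction \<alpha>)"]) auto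
  then show ?thesis
    using flow_line_0[OF g] flow_line_rho[OF g] flow_line_nonconical[OF g] assms(2)
    unfolding trajectory_def by (auto simp: closed_segment_eq_real_ivl open_segment_eq_real_ivl)
qed

text \<open>Slope 0 is vertical and runs along the sides of the tiles; any other real slope is
  transverse to both families of sides, as the construction of flow lines requires.\<close>

lemma direction_nonzero: "\<alpha> \<noteq> 0 \<Longrightarrow> direction \<alpha> $ i \<noteq> 0"
  using exhaust_2[of i] add_pos_nonneg[of 1 "\<alpha>\<^sup>2"]
  by (auto simp: direction_def sin_arctan cos_arctan_not_zero)

text \<open>This gives the description in \<open>linear_flow\<close> its meaning. A flow line that
  stopped early would end at a conical point and put \<open>p\<close> on a singular leaf, so one
  exists up to time \<open>t\<close>; \<open>lift_unique\<close> shows that its values are the only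
  ones.\<close>

lemma linear_flow_trajectory:
  assumes \<alpha>: "\<alpha> \<noteq> 0" and p: "p \<in> points X - singular_leaves X \<alpha>" and t: "0 \<le> t"
  shows "trajectory X \<alpha> p t (\<lambda>s. linear_flow X \<alpha> s p)"
    and "s \<in> {0..t} \<Longrightarrow> linear_flow X \<alpha> s p \<notin> conical_points X"
proof -
  obtain s0 \<gamma> where s0: "0 \<le> s0" "s0 \<le> t" "flow_line (direction \<alpha>) p s0 \<gamma>"
      "s0 = t \<or> \<gamma> s0 \<in> conical_points X"
    using flow_line_exists[OF direction_nonzero[OF \<alpha>] DiffD1[OF p] t] .
  \<comment> \<open>Applied to every shorter time, this excludes conical points along the whole line
    and not only at its end.\<close>
  have p_nc: "\<delta> s \<notin> conical_points X" if "trajectory X \<alpha> p s \<delta>" for s \<delta>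
    using p that unfolding singular_leaves_def by blast
  have "trajectory X \<alpha> p s0 \<gamma>" using flow_line_imp_trajectory[OF s0(3,1)] .
  moreover from this have "\<gamma> s0 \<notin> conical_points X" by (rule p_nc)
  ultimately have g: "trajectory X \<alpha> p t \<gamma>" using s0(4) by simp
  have nc: "\<gamma> s \<notin> conical_points X" if "s \<in> {0..t}" for s
    using p_nc[OF trajectory_restrict[OF g, of s]] that by simp
  have lin: "linear_flow X \<alpha> s p = \<gamma> s" if s: "s \<in> {0..t}" for s
    unfolding linear_flow_def
  proof (rule the_equality)
    have gs: "trajectory X \<alpha> p s \<gamma>" using trajectory_restrict[OF g] s by simp
    then show "\<exists>\<gamma>'. trajectory X \<alpha> p s \<gamma>' \<and> \<gamma>' s = \<gamma> s" by blast
    fix q assume "\<exists>\<gamma>'. trajectory X \<alpha> p s \<gamma>' \<and> \<gamma>' s = q"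
    then obtain \<gamma>' where g': "trajectory X \<alpha> p s \<gamma>'" "\<gamma>' s = q" by blast
    have "\<gamma> s = \<gamma>' s"
    proof (rule lift_unique)
      show "continuous_path X {0..s} \<gamma>" "continuous_path X {0..s} \<gamma>'" "\<gamma> 0 = \<gamma>' 0" "0 \<le> s"
        using gs g'(1) s unfolding trajectory_def by (simp_all add: closed_segment_eq_real_ivl)
      show "rho (\<gamma> r) = rho (\<gamma>' r)" if "r \<in> {0..s}" for r
        using gs g'(1) s that unfolding trajectory_def by (simp add: closed_segment_eq_real_ivl)
      show "\<gamma> r \<notin> conical_points X" if "r \<in> {0..s}" for r using nc s that by simp
    qed
    then show "q = \<gamma> s" using g'(2) by simp
  qed
  show "s \<in> {0..t} \<Longrightarrow> linear_flow X \<alpha> s p \<notin> conical_points X" using lin nc by simp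
  have cong: "continuous_path X {0..t} (\<lambda>s. linear_flow X \<alpha> s p)" if "continuous_path X {0..t} \<gamma>"
    unfolding continuous_path_def
  proof (intro conjI ballI)
    fix s assume s: "s \<in> {0..t}"
    show "linear_flow X \<alpha> s p \<in> points X" using that lin[OF s] s unfolding continuous_path_def by simp
    have "((\<lambda>r. Dist X (\<gamma> r) (\<gamma> s)) \<longlongrightarrow> 0) (at s within {0..t})"
      using that s unfolding continuous_path_def by simp
    moreover have "\<forall>\<^sub>F r in at s within {0..t}. Dist X (\<gamma> r) (\<gamma> s) = Dist X (linear_flow X \<alpha> r p) (linear_flow X \<alpha> s p)"
      using lin s by (simp add: eventually_at_filter)
    ultimately show "((\<lambda>r. Dist X (linear_flow X \<alpha> r p) (linear_flow X \<alpha> s p)) \<longlongrightarrow> 0) (at s within {0..t})"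
      by (rule Lim_transform_eventually)
  qed
  show "trajectory X \<alpha> p t (\<lambda>s. linear_flow X \<alpha> s p)"
    using g t lin cong unfolding trajectory_def
    by (simp add: closed_segment_eq_real_ivl open_segment_eq_real_ivl)
qed

end

section \<open>Transport of segments along the action of SL(2,Z)\<close>

lemma SL2Z_inverse:
  assumes "B \<in> SL2Z"
  obtains C where "C \<in> SL2Z" "B ** C = mat 1" "C ** B = mat 1"
proof -
  have d: "B$1$1 * B$2$2 - B$1$2 * B$2$1 = 1" and z: "\<And>i j. B $ i $ j \<in> \<int>"
    using assms by (auto simp: SL2Z_def det_2)
  define C :: "real^2^2" where "C = vector [vector [B$2$2, - B$1$2], vector [- B$2$1, B$1$1]]"
  have "C \<in> SL2Z"
    using z d by (auto simp: SL2Z_def det_2 C_def forall_2 mult.commute)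
  moreover have "B ** C = mat 1" "C ** B = mat 1"
    using d by (simp_all add: C_def vec_eq_iff forall_2 matrix_matrix_mult_def sum_2 mat_def mult.commute)
  ultimately show ?thesis by (rule that)
qed

text \<open>The affine map from S to B S. As \<open>act\<close> changes nothing but the frame, it is
  the matrix B in every tile, and no cutting into new squares takes place.\<close>

definition frame_map :: "real^2^2 \<Rightarrow> 'q \<times> (real^2) \<Rightarrow> 'q \<times> (real^2)" where
  "frame_map B a = (fst a, B *v snd a)"

definition point_map :: "real^2^2 \<Rightarrow> 'q point \<Rightarrow> 'q point" where
  "point_map B p = frame_map B ` p"

lemma frame_map_inverse: "C ** B = mat 1 \<Longrightarrow> frame_map C (frame_map B a) = a"
  by (simp add: frame_map_def matrix_vector_mul_assoc)

lemma point_map_inverse: "C ** B = mat 1 \<Longrightarrow> point_map C (point_map B p) = p"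
  by (simp add: point_map_def image_image frame_map_inverse)

lemma act_inverse: "C ** B = mat 1 \<Longrightarrow> act C (act B S) = S"
  by (simp add: act_def matrix_mul_assoc)

lemma frame_map_tile_points: "a \<in> tile_points S \<Longrightarrow> frame_map B a \<in> tile_points (act B S)"
  by (force simp: tile_points_def frame_map_def act_def matrix_vector_mul_assoc[symmetric])

lemma frame_map_side_glue:
  "(a, b) \<in> side_glue S \<Longrightarrow> (frame_map B a, frame_map B b) \<in> side_glue (act B S)"
  unfolding side_glue_def frame_map_def act_def by (auto simp: matrix_vector_mul_assoc[symmetric])

lemma frame_map_glue:
  assumes "(a, b) \<in> glue S"
  shows "(frame_map B a, frame_map B b) \<in> glue (act B S)"
proof -
  have "(frame_map B a, frame_map B b) \<in> (side_glue (act B S) \<union> (side_glue (act B S))\<inverse>)\<^sup>*"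
    if "(a, b) \<in> (side_glue S \<union> (side_glue S)\<inverse>)\<^sup>*" using that
  proof (induction rule: rtrancl_induct)
    case (step b c)
    then have "(frame_map B b, frame_map B c) \<in> side_glue (act B S) \<union> (side_glue (act B S))\<inverse>"
      using frame_map_side_glue[of b c S B] frame_map_side_glue[of c b S B] by auto
    with step(3) show ?case by (rule rtrancl_into_rtrancl)
  qed simp
  then show ?thesis
    using assms frame_map_tile_points[of a S B] frame_map_tile_points[of b S B]
    unfolding glue_def by auto
qed

text \<open>The image of a gluing class is a whole class, because the inverse matrix carries the
  gluing of \<open>act B S\<close> back to that of \<open>S\<close>.\<close>

lemma point_map_points:
  assumes B: "B \<in> SL2Z" and p: "p \<in> points S"
  shows "point_map B p \<in> points (act B S)"
proof -
  obtain C where C: "B ** C = mat 1" "C ** B = mat 1" using SL2Z_inverse[OF B] .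
  obtain a where a: "a \<in> tile_points S" "p = glue S `` {a}"
    using p unfolding points_def by (auto elim: quotientE)
  have "b \<in> point_map B p" if b: "(frame_map B a, b) \<in> glue (act B S)" for b
  proof -
    have "(a, frame_map C b) \<in> glue S"
      using frame_map_glue[OF b, of C] by (simp add: act_inverse C frame_map_inverse)
    then have "frame_map B (frame_map C b) \<in> point_map B p" unfolding point_map_def a(2) by blast
    then show ?thesis by (simp add: frame_map_inverse C)
  qed
  then have "point_map B p = glue (act B S) `` {frame_map B a}"
    using frame_map_glue[of a _ S B] unfolding a(2) point_map_def by auto
  then show ?thesis unfolding points_def using frame_map_tile_points[OF a(1)] by (simp add: quotientI)
qed

lemma matrix_vector_mult_bound:
  fixes B :: "real^'n^'m"
  obtains K where "K > 0" "\<And>x. norm (B *v x) \<le> norm x * K"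
  using bounded_linear.pos_bounded[OF matrix_vector_mul_bounded_linear[of B]] by blast

lemma point_map_broken_path:
  assumes B: "B \<in> SL2Z" and K: "\<And>x. norm (B *v x) \<le> norm x * K"
    and "broken_path S p q l"
  shows "\<exists>l' \<le> l * K. broken_path (act B S) (point_map B p) (point_map B q) l'"
  using assms(3)
proof (induction rule: broken_path.induct)
  case 1
  then show ?case using broken_path.intros(1)[OF point_map_points[OF B]] by force
next
  case (2 q l q' j x y)
  then obtain l' where l': "l' \<le> l * K" "broken_path (act B S) (point_map B p) (point_map B q) l'" by blast
  have "(j, B *v x) \<in> point_map B q" "(j, B *v y) \<in> point_map B q'"
    using 2(3,4) unfolding point_map_def frame_map_def by force+
  then have "broken_path (act B S) (point_map B p) (point_map B q') (l' + dist (B *v x) (B *v y))"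
    using broken_path.intros(2)[OF l'(2) point_map_points[OF B 2(2)]] by blast
  moreover have "dist (B *v x) (B *v y) \<le> dist x y * K"
    using K[of "x - y"] by (simp add: dist_norm matrix_vector_mult_diff_distrib)
  ultimately show ?case using l'(1) by (intro exI conjI) (auto simp: distrib_right)
qed

lemma points_act_eq:
  assumes "B \<in> SL2Z"
  shows "points (act B S) = point_map B ` points S"
proof -
  obtain C where C: "C \<in> SL2Z" "B ** C = mat 1" "C ** B = mat 1" using SL2Z_inverse[OF assms] .
  have "q \<in> point_map B ` points S" if "q \<in> points (act B S)" for q
    using point_map_points[OF C(1) that] point_map_inverse[OF C(2), of q] act_inverse[OF C(3), of S]
    by (metis image_eqI)
  then show ?thesis using point_map_points[OF assms] by blast
qed

lemma path_connected_act:
  assumes B: "B \<in> SL2Z" and S: "path_connected_surface S"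
  shows "path_connected_surface (act B S)"
proof -
  obtain K where K: "K > 0" "\<And>x. norm (B *v x) \<le> norm x * K" using matrix_vector_mult_bound[of B] by blast
  show ?thesis
    using S point_map_broken_path[OF B K(2)] unfolding path_connected_surface_def points_act_eq[OF B]
    by blast
qed

text \<open>A linear map stretches each piece of a broken path by at most a constant factor. Applied
  to B and to its inverse, this transports convergence and small balls.\<close>

lemma point_map_Dist:
  assumes B: "B \<in> SL2Z" and S: "path_connected_surface S"
  obtains K where "K > 0"
    "\<And>p q. p \<in> points S \<Longrightarrow> q \<in> points S \<Longrightarrow>
      Dist (act B S) (point_map B p) (point_map B q) \<le> K * Dist S p q"
proof -
  obtain K where K: "K > 0" "\<And>x. norm (B *v x) \<le> norm x * K" using matrix_vector_mult_bound[of B] by blast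
  have "Dist (act B S) (point_map B p) (point_map B q) \<le> K * Dist S p q"
    if pq: "p \<in> points S" "q \<in> points S" for p q
  proof (rule field_le_epsilon)
    fix e :: real assume "e > 0"
    then obtain l where l: "broken_path S p q l" "l < Dist S p q + e / K"
      using Dist_less_imp_path[OF S pq, of "Dist S p q + e / K"] K by auto
    obtain l' where l': "l' \<le> l * K" "broken_path (act B S) (point_map B p) (point_map B q) l'"
      using point_map_broken_path[OF B K(2) l(1)] by blast
    have "Dist (act B S) (point_map B p) (point_map B q) \<le> l * K"
      using Dist_le[OF l'(2)] l'(1) by simp
    also have "\<dots> \<le> (Dist S p q + e / K) * K" using l(2) K(1) by (intro mult_right_mono) auto
    also have "\<dots> = K * Dist S p q + e" using K(1) by (simp add: algebra_simps)
    finally show "Dist (act B S) (point_map B p) (point_map B q) \<le> K * Dist S p q + e" .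
  qed
  with K(1) show ?thesis by (rule that)
qed

text \<open>Both B and its inverse have integer entries and so preserve the integer lattice; each
  gives one inclusion.\<close>

lemma torus_matrix:
  assumes B: "B \<in> SL2Z"
  shows "torus (B *v x) = (*v) B ` torus x"
proof -
  have sub: "(*v) B ` torus x \<subseteq> torus (B *v x)" if "B \<in> SL2Z" for B x
  proof
    fix y assume "y \<in> (*v) B ` torus x"
    then obtain n where n: "y = B *v (x + n)" "\<forall>i. n $ i \<in> \<int>" unfolding torus_def by auto
    have "\<forall>i. (B *v n) $ i \<in> \<int>"
      using that n(2) unfolding matrix_vector_mult_def SL2Z_def by auto
    then show "y \<in> torus (B *v x)"
      unfolding torus_def n(1) by (auto simp: matrix_vector_right_distrib)
  qed
  obtain C where C: "C \<in> SL2Z" "B ** C = mat 1" "C ** B = mat 1" using SL2Z_inverse[OF B] .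
  have "y \<in> (*v) B ` torus x" if "y \<in> torus (B *v x)" for y
  proof -
    have "C *v y \<in> torus (C *v (B *v x))" using sub[OF C(1)] that by blast
    then have "C *v y \<in> torus x" by (simp add: matrix_vector_mul_assoc C)
    then have "B *v (C *v y) \<in> (*v) B ` torus x" by blast
    then show ?thesis by (simp add: matrix_vector_mul_assoc C)
  qed
  then show ?thesis using sub[OF B] by blast
qed

lemma rho_point_map:
  assumes B: "B \<in> SL2Z"
  shows "rho (point_map B p) = (*v) B ` rho p"
  unfolding rho_def point_map_def frame_map_def by (force simp: torus_matrix[OF B])

text \<open>\<open>rho\<close> intertwines \<open>point_map B\<close> with B, so its injectivity
  near \<open>p\<close> passes to the image; the radius shrinks by the Lipschitz constant of the
  inverse.\<close>

lemma point_map_nonconical: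
  assumes B: "B \<in> SL2Z" and S: "path_connected_surface S"
    and p: "p \<in> points S" "p \<notin> conical_points S"
  shows "point_map B p \<notin> conical_points (act B S)"
proof -
  obtain C where C: "C \<in> SL2Z" "B ** C = mat 1" "C ** B = mat 1" using SL2Z_inverse[OF B] .
  obtain e where e: "e > 0" "inj_on rho {q \<in> points S. Dist S p q < e}"
    using p unfolding conical_points_def by auto
  obtain K where K: "K > 0" "\<And>q q'. q \<in> points (act B S) \<Longrightarrow> q' \<in> points (act B S) \<Longrightarrow>
      Dist S (point_map C q) (point_map C q') \<le> K * Dist (act B S) q q'"
    using point_map_Dist[OF C(1) path_connected_act[OF B S]] act_inverse[OF C(3), of S] by metis
  let ?U = "{q \<in> points (act B S). Dist (act B S) (point_map B p) q < e / K}"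
  have U: "point_map C q \<in> {q \<in> points S. Dist S p q < e}" if "q \<in> ?U" for q
  proof -
    have "Dist S p (point_map C q) \<le> K * Dist (act B S) (point_map B p) q"
      using K(2)[OF point_map_points[OF B p(1)], of q] that by (simp add: point_map_inverse C)
    also have "\<dots> < e" using that K(1) by (simp add: pos_less_divide_eq mult.commute)
    finally show ?thesis using point_map_points[OF C(1), of q "act B S"] that by (simp add: act_inverse C)
  qed
  have "inj_on rho ?U"
  proof (rule inj_onI)
    fix q q' assume q: "q \<in> ?U" "q' \<in> ?U" "rho q = rho q'"
    have "rho (point_map C q) = rho (point_map C q')" using q(3) by (simp add: rho_point_map C)
    then have "point_map C q = point_map C q'" using inj_onD[OF e(2) _ U[OF q(1)] U[OF q(2)]] by simp
    then have "point_map B (point_map C q) = point_map B (point_map C q')" by simp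
    then show "q = q'" by (simp add: point_map_inverse C)
  qed
  moreover have "e / K > 0" using e K by simp
  ultimately show ?thesis unfolding conical_points_def by blast
qed

definition segment_map :: "real^2^2 \<Rightarrow> 'q segment \<Rightarrow> 'q segment" where
  "segment_map B c =
     c\<lparr>seg_path := (\<lambda>t. point_map B (seg_path c t)), seg_velocity := B *v seg_velocity c\<rparr>"

lemma segment_map_is_segment:
  assumes B: "B \<in> SL2Z" and S: "path_connected_surface S" and c: "is_segment S c"
  shows "is_segment (act B S) (segment_map B c)"
proof -
  obtain K where K: "K > 0" "\<And>p q. p \<in> points S \<Longrightarrow> q \<in> points S \<Longrightarrow>
      Dist (act B S) (point_map B p) (point_map B q) \<le> K * Dist S p q"
    using point_map_Dist[OF B S] by blast
  let ?I = "seg_domain c" and ?\<gamma> = "seg_path c"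
  have P: "?\<gamma> t \<in> points S" if "t \<in> ?I" for t
    using c that unfolding is_segment_def continuous_path_def by auto
  have "((\<lambda>s. Dist (act B S) (point_map B (?\<gamma> s)) (point_map B (?\<gamma> t))) \<longlongrightarrow> 0) (at t within ?I)"
    if t: "t \<in> ?I" for t
  proof (rule tendsto_sandwich[of "\<lambda>_. 0" _ _ "\<lambda>s. K * Dist S (?\<gamma> s) (?\<gamma> t)"])
    have I: "\<forall>\<^sub>F s in at t within ?I. s \<in> ?I" by (simp add: eventually_at_filter)
    show "\<forall>\<^sub>F s in at t within ?I. 0 \<le> Dist (act B S) (point_map B (?\<gamma> s)) (point_map B (?\<gamma> t))"
      using I by eventually_elim
        (use P t in \<open>auto intro!: Dist_nonneg[OF path_connected_act[OF B S]] point_map_points[OF B]\<close>)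
    show "\<forall>\<^sub>F s in at t within ?I. Dist (act B S) (point_map B (?\<gamma> s)) (point_map B (?\<gamma> t))
        \<le> K * Dist S (?\<gamma> s) (?\<gamma> t)"
      using I by eventually_elim (use K(2) P t in auto)
    have "((\<lambda>s. K * Dist S (?\<gamma> s) (?\<gamma> t)) \<longlongrightarrow> K * 0) (at t within ?I)"
      using c t unfolding is_segment_def continuous_path_def by (intro tendsto_intros) auto
    then show "((\<lambda>s. K * Dist S (?\<gamma> s) (?\<gamma> t)) \<longlongrightarrow> 0) (at t within ?I)" by simp
  qed simp
  then have cont: "continuous_path (act B S) ?I (\<lambda>t. point_map B (?\<gamma> t))"
    unfolding continuous_path_def using P point_map_points[OF B] by blast
  have "has_torus_derivative (\<lambda>s. rho (point_map B (?\<gamma> s))) (B *v seg_velocity c) t" if t: "t \<in> ?I" for t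
  proof -
    obtain g where g: "\<forall>\<^sub>F s in nhds t. rho (?\<gamma> s) = torus (g s)"
        "(g has_vector_derivative seg_velocity c) (at t)"
      using c t unfolding is_segment_def has_torus_derivative_def by blast
    have "\<forall>\<^sub>F s in nhds t. rho (point_map B (?\<gamma> s)) = torus (B *v g s)"
      using g(1) by eventually_elim (simp add: rho_point_map[OF B] torus_matrix[OF B])
    moreover have "((\<lambda>s. B *v g s) has_vector_derivative B *v seg_velocity c) (at t)"
      using bounded_linear.has_vector_derivative[OF matrix_vector_mul_bounded_linear g(2)] .
    ultimately show ?thesis
      unfolding has_torus_derivative_def by (intro exI[of _ "\<lambda>s. B *v g s"] conjI)
  qed
  with cont show ?thesis
    using c P point_map_nonconical[OF B S]
    unfolding is_segment_def segment_map_def seg_domain_def by auto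
qed

lemma seg_trace_segment_map: "seg_trace (segment_map B c) = point_map B ` seg_trace c"
  unfolding seg_trace_def segment_map_def seg_domain_def by (auto simp: image_image)

lemma seg_traces_meet_if_segment_maps_meet:
  assumes "B \<in> SL2Z" "seg_trace (segment_map B c) \<inter> seg_trace (segment_map B d) \<noteq> {}"
  shows "seg_trace c \<inter> seg_trace d \<noteq> {}"
proof -
  obtain C where "C ** B = mat 1" using SL2Z_inverse[OF assms(1)] by blast
  then have "inj (point_map B)" by (metis injI point_map_inverse)
  then show ?thesis using assms(2) unfolding seg_trace_segment_map by (auto dest: injD)
qed

section \<open>Diophantine approximation\<close>

lemma irrational_combination_nonzero:
  fixes q p :: int
  assumes "\<alpha> \<notin> \<rat>" "q \<noteq> 0"
  shows "of_int q * \<alpha> - of_int p \<noteq> (0::real)"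
proof
  assume "of_int q * \<alpha> - of_int p = 0"
  then have "\<alpha> = of_int p / of_int q" using assms(2) by (simp add: field_simps)
  then show False using assms(1) by auto
qed

text \<open>The relation between two consecutive convergents \<open>p / q\<close> and \<open>p' / q'\<close> of \<open>\<alpha>\<close>.\<close>

definition consecutive :: "real \<Rightarrow> int \<Rightarrow> int \<Rightarrow> int \<Rightarrow> int \<Rightarrow> bool" where
  "consecutive \<alpha> q p q' p' \<longleftrightarrow>
     0 \<le> q \<and> q \<le> q' \<and> 1 \<le> q' \<and> \<bar>q * p' - p * q'\<bar> = 1 \<and>
     (of_int q * \<alpha> - of_int p) * (of_int q' * \<alpha> - of_int p') < 0 \<and>
     \<bar>of_int q' * \<alpha> - of_int p'\<bar> < \<bar>of_int q * \<alpha> - of_int p\<bar>"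

text \<open>The sequence of convergents begins with the formal fraction 1/0, whose error is -1,
  followed by the integer part.\<close>

lemma consecutive_start:
  assumes "\<alpha> \<notin> \<rat>"
  shows "consecutive \<alpha> 0 1 1 \<lfloor>\<alpha>\<rfloor>"
proof -
  have "\<alpha> - of_int \<lfloor>\<alpha>\<rfloor> \<noteq> 0" using irrational_combination_nonzero[OF assms, of 1] by simp
  then show ?thesis
    using of_int_floor_le[of \<alpha>] real_of_int_floor_add_one_gt[of \<alpha>]
    unfolding consecutive_def by (auto; linarith)
qed

text \<open>One step of the continued fraction algorithm. The partial quotient \<open>a\<close> is
  the integer part of the ratio of the errors; these have opposite signs, so adding \<open>a\<close>
  copies of the smaller error to the larger one leaves the remainder of a division.\<close>

lemma consecutive_step:
  assumes \<alpha>: "\<alpha> \<notin> \<rat>" and c: "consecutive \<alpha> q p q' p'"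
  obtains q'' p'' where "consecutive \<alpha> q' p' q'' p''" "q + q' \<le> q''"
proof -
  define \<delta> where "\<delta> = of_int q * \<alpha> - of_int p"
  define \<delta>' where "\<delta>' = of_int q' * \<alpha> - of_int p'"
  define a where "a = \<lfloor>\<bar>\<delta>\<bar> / \<bar>\<delta>'\<bar>\<rfloor>"
  have \<delta>: "\<delta> * \<delta>' < 0" "\<bar>\<delta>'\<bar> < \<bar>\<delta>\<bar>"
    and q: "0 \<le> q" "q \<le> q'" "1 \<le> q'" and det: "\<bar>q * p' - p * q'\<bar> = 1"
    using c unfolding consecutive_def \<delta>_def \<delta>'_def by auto
  have \<delta>'0: "\<bar>\<delta>'\<bar> > 0" using \<delta>(1) by auto
  have a1: "1 \<le> a" unfolding a_def using \<delta>(2) \<delta>'0 by (simp add: le_floor_iff)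
  have a: "of_int a * \<bar>\<delta>'\<bar> \<le> \<bar>\<delta>\<bar>" "\<bar>\<delta>\<bar> < of_int a * \<bar>\<delta>'\<bar> + \<bar>\<delta>'\<bar>"
    using of_int_floor_le[of "\<bar>\<delta>\<bar> / \<bar>\<delta>'\<bar>"] real_of_int_floor_add_one_gt[of "\<bar>\<delta>\<bar> / \<bar>\<delta>'\<bar>"] \<delta>'0
    unfolding a_def[symmetric] by (simp_all add: pos_le_divide_eq pos_divide_less_eq distrib_right)
  define q'' p'' where "q'' = q + a * q'" and "p'' = p + a * p'"
  define \<delta>'' where "\<delta>'' = of_int q'' * \<alpha> - of_int p''"
  have "1 * q' \<le> a * q'" using a1 q by (intro mult_right_mono) auto
  then have q'': "q + q' \<le> q''" unfolding q''_def by simp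
  have eq: "\<delta>'' = \<delta> + of_int a * \<delta>'"
    unfolding \<delta>''_def \<delta>_def \<delta>'_def q''_def p''_def by (simp add: algebra_simps)
  have "\<delta>'' \<noteq> 0" unfolding \<delta>''_def using irrational_combination_nonzero[OF \<alpha>, of q''] q q'' by simp
  \<comment> \<open>The floor alone would allow remainder 0; that case is left open here and
    excluded by irrationality.\<close>
  moreover have "\<bar>\<delta>''\<bar> < \<bar>\<delta>'\<bar> \<and> (\<delta>'' = 0 \<or> \<delta>' * \<delta>'' < 0)"
  proof (cases "\<delta>' > 0")
    case True
    then have "\<delta> < 0" using \<delta>(1) by (simp add: mult_less_0_iff)
    then show ?thesis using True a unfolding eq by (auto simp: mult_less_0_iff)
  next
    case False
    then have "\<delta>' < 0" "\<delta> > 0" using \<delta>(1) by (auto simp: mult_less_0_iff)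
    then show ?thesis using a unfolding eq by (auto simp: mult_less_0_iff)
  qed
  moreover have "q' * p'' - p' * q'' = - (q * p' - p * q')"
    unfolding q''_def p''_def by (simp add: algebra_simps)
  then have "\<bar>q' * p'' - p' * q''\<bar> = 1" using det by simp
  ultimately have "consecutive \<alpha> q' p' q'' p''"
    using q q'' unfolding consecutive_def \<delta>''_def \<delta>'_def by auto
  then show ?thesis using q'' by (rule that)
qed

lemma consecutive_around:
  fixes M :: real
  assumes \<alpha>: "\<alpha> \<notin> \<rat>" and M: "1 < M"
  obtains q p q' p' where "consecutive \<alpha> q p q' p'" "1 \<le> q" "of_int q < M" "M \<le> of_int q'"
proof -
  have ex: "\<exists>q p q' p'. consecutive \<alpha> q p q' p' \<and> q < int (Suc n) \<and> int (Suc n) \<le> q'" for n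
  proof (induction n)
    case 0
    then show ?case using consecutive_start[OF \<alpha>] by force
  next
    case (Suc n)
    then obtain q p q' p' where c: "consecutive \<alpha> q p q' p'" "q < int (Suc n)" "int (Suc n) \<le> q'"
      by blast
    \<comment> \<open>Two steps are taken because a denominator may repeat: after the start 0, 1 the
      next one can be 1 again. The second step adds \<open>q'\<close> and \<open>q2\<close>, which
      is enough to pass the new threshold.\<close>
    obtain q2 p2 where c2: "consecutive \<alpha> q' p' q2 p2" "q + q' \<le> q2" using consecutive_step[OF \<alpha> c(1)] .
    obtain q3 p3 where c3: "consecutive \<alpha> q2 p2 q3 p3" "q' + q2 \<le> q3" using consecutive_step[OF \<alpha> c2(1)] .
    consider "int (Suc (Suc n)) \<le> q'" | "q' < int (Suc (Suc n))" "int (Suc (Suc n)) \<le> q2"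
      | "q2 < int (Suc (Suc n))" by linarith
    then show ?case
    proof cases
      case 3
      then have "int (Suc (Suc n)) \<le> q3" using c(1,3) c2 c3(2) unfolding consecutive_def by linarith
      then show ?thesis using c3(1) 3 by blast
    qed (use c c2 in \<open>force+\<close>)
  qed
  \<comment> \<open>Comparing an integer with M amounts to comparing it with the ceiling of M, so an
    integer threshold suffices.\<close>
  define n where "n = nat (\<lceil>M\<rceil> - 1)"
  have n: "int (Suc n) = \<lceil>M\<rceil>" "n \<ge> 1" unfolding n_def using M by linarith+
  obtain q p q' p' where c: "consecutive \<alpha> q p q' p'" "q < \<lceil>M\<rceil>" "\<lceil>M\<rceil> \<le> q'"
    using ex[of n] unfolding n(1) by blast
  \<comment> \<open>This is where M > 1 enters: with \<open>q = 0\<close> the determinant forces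
    \<open>q' = 1\<close>, which is below M.\<close>
  have "q \<noteq> 0"
  proof
    assume "q = 0"
    then have "\<bar>p\<bar> * q' = 1" using c(1) unfolding consecutive_def by (auto simp: abs_mult)
    then have "q' = 1" using c(1) unfolding consecutive_def by (metis abs_ge_zero mult.commute pos_zmult_eq_1_iff zless_add1_eq zle_add1_eq_le zero_less_one order_less_le_trans)
    then show False using c(3) M by linarith
  qed
  then have "1 \<le> q" using c(1) unfolding consecutive_def by simp
  moreover have "of_int q < M" "M \<le> of_int q'" using c(2,3) by linarith+
  ultimately show ?thesis using that c(1) by blast
qed

section \<open>Exponents of approximation and the type\<close>

definition approximations :: "real \<Rightarrow> real \<Rightarrow> (int \<times> int) set" where
  "approximations \<alpha> w = {(p, q). q > 0 \<and> coprime p q \<and>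
     \<bar>\<alpha> - of_int p / of_int q\<bar> < of_int q powr (- (w + 1))}"

lemma diophantine_type_eq:
  "diophantine_type \<alpha> = Sup {ereal w | w. w > 0 \<and> infinite (approximations \<alpha> w)}"
  unfolding diophantine_type_def approximations_def ..

lemma approximations_antimono: "v \<le> w \<Longrightarrow> approximations \<alpha> w \<subseteq> approximations \<alpha> v"
proof
  fix a assume vw: "v \<le> w" and a: "a \<in> approximations \<alpha> w"
  obtain p q where pq: "a = (p, q)" by fastforce
  then have "real_of_int q powr (- (w + 1)) \<le> real_of_int q powr (- (v + 1))"
    using a vw unfolding approximations_def by (intro powr_mono) auto
  then show "a \<in> approximations \<alpha> v" using a pq unfolding approximations_def by auto
qed

lemma approximations_iff:
  "(p, q) \<in> approximations \<alpha> w \<longleftrightarrow>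
     q > 0 \<and> coprime p q \<and> \<bar>of_int q * \<alpha> - of_int p\<bar> < of_int q powr (- w)"
proof -
  have "\<bar>\<alpha> - of_int p / of_int q\<bar> < of_int q powr (- (w + 1)) \<longleftrightarrow>
      \<bar>of_int q * \<alpha> - of_int p\<bar> < of_int q powr (- w)" if "q > 0"
  proof -
    have q: "real_of_int q > 0" using that by simp
    have "of_int q * \<alpha> - of_int p = of_int q * (\<alpha> - of_int p / of_int q)"
      using q by (simp add: field_simps)
    then have 1: "\<bar>of_int q * \<alpha> - of_int p\<bar> = of_int q * \<bar>\<alpha> - of_int p / of_int q\<bar>"
      using q by (simp add: abs_mult)
    have 2: "of_int q powr (- w) = real_of_int q * of_int q powr (- (w + 1))"
      using q by (simp add: powr_mult_base)
    show ?thesis unfolding 1 2 using q by simp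
  qed
  then show ?thesis unfolding approximations_def by auto
qed

lemma approximations_infinite_below_type:
  assumes "ereal w < diophantine_type \<alpha>"
  shows "infinite (approximations \<alpha> w)"
proof -
  obtain v where "w < v" "infinite (approximations \<alpha> v)"
    using assms unfolding diophantine_type_eq less_Sup_iff by auto
  then show ?thesis using finite_subset[OF approximations_antimono[of w v \<alpha>]] by auto
qed

lemma approximations_finite_above_type:
  assumes "diophantine_type \<alpha> < ereal w" "w > 0"
  shows "finite (approximations \<alpha> w)"
proof (rule ccontr)
  assume "infinite (approximations \<alpha> w)"
  then have "ereal w \<le> diophantine_type \<alpha>"
    unfolding diophantine_type_eq using assms(2) by (intro Sup_upper) auto
  then show False using assms(1) by simp
qed

text \<open>Dirichlet's theorem: for exponent 1 the set is the \<open>approx_set\<close> of the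
  library, which is infinite for irrational numbers. It makes every exponent above the type exceed 1
  and keeps the type itself positive.\<close>

lemma diophantine_type_ge_1:
  assumes "\<alpha> \<notin> \<rat>"
  shows "1 \<le> diophantine_type \<alpha>"
proof -
  have "of_int k powr - 2 = 1 / (real_of_int k)\<^sup>2" if "k > 0" for k :: int
    using that powr_minus[of "real_of_int k" 2] powr_numeral[of "real_of_int k" "num.Bit0 num.One"]
    by (simp add: divide_inverse)
  then have "approximations \<alpha> 1 = approx_set \<alpha>"
    unfolding approximations_def approx_set_def by auto
  then have "infinite (approximations \<alpha> 1)"
    using rational_iff_finite_approx_set assms by simp
  then have "ereal 1 \<le> diophantine_type \<alpha>"
    unfolding diophantine_type_eq by (intro Sup_upper) auto
  then show ?thesis by (simp add: one_ereal_def)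
qed

text \<open>Outside the finite set the bound holds with constant 1; on its finitely many members the
  smallest error serves, and it is positive by irrationality.\<close>

lemma approximation_lower_bound:
  assumes \<alpha>: "\<alpha> \<notin> \<rat>" and w: "w > 0" and fin: "finite (approximations \<alpha> w)"
  obtains c :: real where "c > 0" "\<And>q p :: int. q > 0 \<Longrightarrow> coprime p q \<Longrightarrow>
    c * of_int q powr (- w) \<le> \<bar>of_int q * \<alpha> - of_int p\<bar>"
proof -
  define f where "f = (\<lambda>(p, q). \<bar>of_int q * \<alpha> - real_of_int p\<bar>)"
  define c where "c = Min (insert 1 (f ` approximations \<alpha> w))"
  have c: "c \<le> 1" "\<And>a. a \<in> approximations \<alpha> w \<Longrightarrow> c \<le> f a" unfolding c_def using fin by auto
  have "f a > 0" if "a \<in> approximations \<alpha> w" for a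
    using that irrational_combination_nonzero[OF \<alpha>, of "snd a" "fst a"]
    unfolding f_def approximations_def by auto
  then have "c > 0" unfolding c_def using fin by auto
  moreover have "c * of_int q powr (- w) \<le> \<bar>of_int q * \<alpha> - of_int p\<bar>"
    if q: "q > 0" "coprime p q" for q p :: int
  proof (cases "(p, q) \<in> approximations \<alpha> w")
    case True
    have "of_int q powr (- w) \<le> (of_int q :: real) powr 0" using q w by (intro powr_mono) auto
    then have "c * of_int q powr (- w) \<le> c * 1" using \<open>c > 0\<close> q by (intro mult_left_mono) auto
    then show ?thesis using c(2)[OF True] unfolding f_def by simp
  next
    case False
    then have "of_int q powr (- w) \<le> \<bar>of_int q * \<alpha> - of_int p\<bar>"
      using q unfolding approximations_iff by simp
    moreover have "c * of_int q powr (- w) \<le> of_int q powr (- w)"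
      using c(1) mult_right_mono[of c 1 "of_int q powr (- w)"] by simp
    ultimately show ?thesis by linarith
  qed
  ultimately show ?thesis by (rule that)
qed

section \<open>Bounds for the hitting time\<close>

lemma direction_eq: "direction \<alpha> = cos (arctan \<alpha>) *\<^sub>R vector [\<alpha>, 1]"
  by (simp add: direction_def vec_eq_iff forall_2 sin_arctan cos_arctan)

lemma cos_arctan_pos: "cos (arctan \<alpha>) > 0"
  by (simp add: cos_arctan add_pos_nonneg)

context origami_surface
begin

lemma linear_segment:
  assumes "a < b" "continuous_path X {a<..<b} \<gamma>"
    and "\<And>s. s \<in> {a<..<b} \<Longrightarrow> \<gamma> s \<notin> conical_points X"
    and rho: "\<And>s. s \<in> {a<..<b} \<Longrightarrow> rho (\<gamma> s) = torus (x + s *\<^sub>R u)"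
  shows "is_segment X \<lparr>seg_start = a, seg_end = b, seg_path = \<gamma>, seg_velocity = u\<rparr>"
proof -
  have "has_torus_derivative (\<lambda>s. rho (\<gamma> s)) u t" if t: "t \<in> {a<..<b}" for t
    unfolding has_torus_derivative_def
  proof (intro exI[of _ "\<lambda>s. x + s *\<^sub>R u"] conjI)
    have "\<forall>\<^sub>F s in nhds t. s \<in> {a<..<b}" using t by (intro eventually_nhds_in_open) auto
    then show "\<forall>\<^sub>F s in nhds t. rho (\<gamma> s) = torus (x + s *\<^sub>R u)"
      by eventually_elim (rule rho)
    show "((\<lambda>s. x + s *\<^sub>R u) has_vector_derivative u) (at t)"
      by (auto intro!: derivative_eq_intros)
  qed
  then show ?thesis unfolding is_segment_def seg_domain_def using assms by simp
qed

lemma horizontal_segment_near: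
  assumes p: "p \<in> points X" and r: "0 < r" "r < 1"
  obtains \<gamma> where
    "is_segment X \<lparr>seg_start = 0, seg_end = r / 2, seg_path = \<gamma>, seg_velocity = vector [1, 0]\<rparr>"
    "\<And>t. t \<in> {0<..<r / 2} \<Longrightarrow> Dist X (\<gamma> t) p < r"
proof -
  obtain j x where x: "(j, x) \<in> p" using point_nonempty[OF p] .
  have j: "j \<in> tiles X" and x01: "0 \<le> x $ i" "x $ i \<le> 1" for i
    using point_mem_tile_points[OF p x] by (auto simp: tile_points_iff)
  \<comment> \<open>The segment goes right or comes from the left, towards the half of the tile with
    more room, and is shifted vertically by r/4 to keep off the sides and hence off conical points.
    Its points are within r/2 + r/4 < r of \<open>x\<close>.\<close>
  define y :: "real^2" where "y = vector [if x $ 1 \<le> 1/2 then x $ 1 else x $ 1 - r / 2,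
    if x $ 2 \<le> 1/2 then x $ 2 + r / 4 else x $ 2 - r / 4]"
  define e :: "real^2" where "e = vector [1, 0]"
  define \<gamma> where "\<gamma> t = point_of X j (y + t *\<^sub>R e)" for t
  have inside: "0 < (y + t *\<^sub>R e) $ i" "(y + t *\<^sub>R e) $ i < 1" if "0 < t" "t < r / 2" for t i
    using that r x01[of 1] x01[of 2] exhaust_2[of i] unfolding y_def e_def by auto
  have tile: "(j, y + t *\<^sub>R e) \<in> tile_points X" if "0 \<le> t" "t \<le> r / 2" for t
    using that r x01[of 1] x01[of 2] j unfolding y_def e_def by (auto simp: tile_points_iff forall_2)
  have y: "point_of X j y \<in> points X" "(j, y) \<in> point_of X j y"
    using point_of_in_points[OF tile[of 0]] mem_point_of[OF tile[of 0]] r by auto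
  have line: "flow_line e (point_of X j y) (r / 2) \<gamma>"
    unfolding \<gamma>_def
    by (rule flow_line_in_tile[OF y]) (use tile inside in \<open>auto simp: tile_points_iff\<close>)
  have "is_segment X \<lparr>seg_start = 0, seg_end = r / 2, seg_path = \<gamma>, seg_velocity = e\<rparr>"
  proof (rule linear_segment)
    show "continuous_path X {0<..<r / 2} \<gamma>"
      using flow_line_point[OF line] flow_line_Dist[OF line]
      by (intro continuous_path_if_Lipschitz[OF path_connected, of _ _ "norm e"]) auto
    show "rho (\<gamma> s) = torus (y + s *\<^sub>R e)" if "s \<in> {0<..<r / 2}" for s
      using flow_line_rho[OF line, of s] that by (simp add: rho_eq[OF y] translate_torus)
  qed (use r flow_line_nonconical[OF line] in auto)
  moreover have "Dist X (\<gamma> t) p < r" if t: "t \<in> {0<..<r / 2}" for t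
  proof -
    have "Dist X (\<gamma> t) p \<le> dist (y + t *\<^sub>R e) x"
      using t tile[of t] unfolding \<gamma>_def
      by (intro Dist_step_le[OF _ p _ x] point_of_in_points mem_point_of) auto
    also have "\<dots> \<le> (\<Sum>i\<in>UNIV. \<bar>(y + t *\<^sub>R e - x) $ i\<bar>)"
      unfolding dist_norm by (rule norm_le_l1_cart)
    also have "\<dots> < r" using t r unfolding y_def e_def by (auto simp: sum_2)
    finally show ?thesis .
  qed
  ultimately show ?thesis unfolding e_def by (rule that)
qed

definition segments_meet :: "real \<Rightarrow> bool" where
  "segments_meet K \<longleftrightarrow>
     (\<forall>Y\<in>SL2Z_orbit X. \<forall>H V. is_segment Y H \<longrightarrow> is_segment Y V \<longrightarrow>
         seg_length H \<ge> K \<longrightarrow> seg_length V \<ge> K \<longrightarrow>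
         (seg_slope H < -1 \<and> 0 < seg_slope V \<and> seg_slope V < 1) \<or>
         (-1 < seg_slope H \<and> seg_slope H < 0 \<and> seg_slope V > 1) \<longrightarrow>
         seg_trace H \<inter> seg_trace V \<noteq> {})"

text \<open>
  The rows of the matrix are orthogonal to \<open>(p, q)\<close> and \<open>(p', q')\<close>, so the flow direction is
  contracted to size \<open>\<bar>q \<alpha> - p\<bar>\<close> while horizontal vectors are stretched by \<open>q'\<close>.
\<close>

lemma flow_meets_horizontal_segment:
  fixes p q p' q' :: int
  assumes K: "segments_meet K"
    and c: "consecutive \<alpha> q p q' p'" "1 \<le> q" "q < q'"
    and H: "is_segment X \<lparr>seg_start = a, seg_end = b, seg_path = \<gamma>, seg_velocity = direction \<alpha>\<rparr>"
    and V: "is_segment X \<lparr>seg_start = c, seg_end = d, seg_path = \<eta>, seg_velocity = vector [1, 0]\<rparr>"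
    and lH: "K \<le> (b - a) * (cos (arctan \<alpha>) * \<bar>of_int q * \<alpha> - of_int p\<bar>)"
    and lV: "K \<le> (d - c) * of_int q'"
  shows "\<gamma> ` {a<..<b} \<inter> \<eta> ` {c<..<d} \<noteq> {}"
proof -
  define \<delta> where "\<delta> = of_int q * \<alpha> - of_int p"
  define \<delta>' where "\<delta>' = of_int q' * \<alpha> - of_int p'"
  define C where "C = cos (arctan \<alpha>)"
  have C: "C > 0" unfolding C_def by (rule cos_arctan_pos)
  have \<delta>: "\<delta> * \<delta>' < 0" "\<bar>\<delta>'\<bar> < \<bar>\<delta>\<bar>" and det: "\<bar>q * p' - p * q'\<bar> = 1"
    using c unfolding consecutive_def \<delta>_def \<delta>'_def by auto
  have ab: "a < b" and cd: "c < d" using H V unfolding is_segment_def by auto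
  let ?H = "\<lparr>seg_start = a, seg_end = b, seg_path = \<gamma>, seg_velocity = direction \<alpha>\<rparr>"
  let ?V = "\<lparr>seg_start = c, seg_end = d, seg_path = \<eta>, seg_velocity = vector [1, 0]\<rparr>"
  \<comment> \<open>The order of the rows is the one that makes the determinant +1 rather than -1.
    Exchanging them inverts both slopes, which exchanges the two alternatives of the
    hypothesis.\<close>
  define A :: "real^2^2" where "A = (if p * q' - q * p' = 1
    then vector [vector [of_int q, - of_int p], vector [of_int q', - of_int p']]
    else vector [vector [of_int q', - of_int p'], vector [of_int q, - of_int p]])"
  have A: "A \<in> SL2Z"
  proof -
    have "det A = 1"
    proof (cases "p * q' - q * p' = 1")
      case True
      have "real_of_int (p * q' - q * p') = 1" by (simp only: True of_int_1)
      then show ?thesis using True by (simp add: A_def det_2 algebra_simps)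
    next
      case False
      then have "q * p' - p * q' = 1" using det by linarith
      then have "real_of_int (q * p' - p * q') = 1" by (simp only: of_int_1)
      then show ?thesis using False by (simp add: A_def det_2 algebra_simps)
    qed
    then show ?thesis unfolding SL2Z_def A_def by (simp add: forall_2)
  qed
  have AH: "A *v direction \<alpha> = (if p * q' - q * p' = 1 then vector [C * \<delta>, C * \<delta>'] else vector [C * \<delta>', C * \<delta>])"
    unfolding direction_eq A_def C_def \<delta>_def \<delta>'_def
    by (simp add: vec_eq_iff forall_2 matrix_vector_mult_def sum_2 algebra_simps)
  have AV: "A *v vector [1, 0] = (if p * q' - q * p' = 1 then vector [of_int q, of_int q'] else vector [of_int q', of_int q])"
    unfolding A_def by (simp add: vec_eq_iff forall_2 matrix_vector_mult_def sum_2)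
  \<comment> \<open>The norms are bounded below by the larger coordinate: the error of
    \<open>q\<close> for the flow direction, \<open>q'\<close> for the horizontal vector.\<close>
  have nH: "C * \<bar>\<delta>\<bar> \<le> norm (A *v direction \<alpha>)"
    using component_le_norm_cart[of "A *v direction \<alpha>" 1] component_le_norm_cart[of "A *v direction \<alpha>" 2] C
    unfolding AH by (auto simp: abs_mult split: if_splits)
  have nV: "of_int q' \<le> norm (A *v vector [1, 0])"
    using component_le_norm_cart[of "A *v vector [1, 0]" 1] component_le_norm_cart[of "A *v vector [1, 0]" 2]
    unfolding AV by (auto split: if_splits)
  have "K \<le> seg_length (segment_map A ?H)"
    using order_trans[OF lH mult_left_mono[OF nH[unfolded C_def \<delta>_def], of "b - a"]] ab
    unfolding seg_length_def segment_map_def by simp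
  moreover have "K \<le> seg_length (segment_map A ?V)"
    using order_trans[OF lV mult_left_mono[OF nV, of "d - c"]] cd
    unfolding seg_length_def segment_map_def by simp
  moreover have "(seg_slope (segment_map A ?H) < -1 \<and> 0 < seg_slope (segment_map A ?V) \<and> seg_slope (segment_map A ?V) < 1) \<or>
      (-1 < seg_slope (segment_map A ?H) \<and> seg_slope (segment_map A ?H) < 0 \<and> seg_slope (segment_map A ?V) > 1)"
  \<comment> \<open>Opposite signs of the errors make the slope of the flow segment negative and
    their strict order keeps it off -1; \<open>q < q'\<close> keeps the other slope off 1.\<close>
  proof (cases "p * q' - q * p' = 1")
    case True
    have "\<delta> / \<delta>' < - 1" using \<delta> by (auto simp: divide_less_eq mult_less_0_iff)
    moreover have "\<delta>' \<noteq> 0" using \<delta>(1) by auto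
    ultimately have "seg_slope (segment_map A ?H) < -1"
      using C unfolding seg_slope_def segment_map_def by (simp add: AH True one_ereal_def)
    then show ?thesis
      using c(2,3) unfolding seg_slope_def segment_map_def by (simp add: AV True one_ereal_def)
  next
    case False
    have "-1 < \<delta>' / \<delta>" "\<delta>' / \<delta> < 0" using \<delta> by (auto simp: less_divide_eq mult_less_0_iff divide_less_0_iff)
    then have "-1 < seg_slope (segment_map A ?H)" "seg_slope (segment_map A ?H) < 0"
      using \<delta> C unfolding seg_slope_def segment_map_def by (auto simp add: AH False one_ereal_def)
    then show ?thesis
      using c(2,3) unfolding seg_slope_def segment_map_def by (simp add: AV False one_ereal_def)
  qed
  moreover have "act A X \<in> SL2Z_orbit X" using A unfolding SL2Z_orbit_def by blast
  ultimately have "seg_trace (segment_map A ?H) \<inter> seg_trace (segment_map A ?V) \<noteq> {}"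
    using K segment_map_is_segment[OF A path_connected H] segment_map_is_segment[OF A path_connected V]
    unfolding segments_meet_def by blast
  then have "seg_trace ?H \<inter> seg_trace ?V \<noteq> {}"
    by (rule seg_traces_meet_if_segment_maps_meet[OF A])
  then show ?thesis unfolding seg_trace_def seg_domain_def by simp
qed

lemma linear_flow_rho:
  assumes "\<alpha> \<noteq> 0" "z \<in> points X - singular_leaves X \<alpha>" "0 \<le> t" "(j, x) \<in> z"
  shows "linear_flow X \<alpha> t z \<in> points X" "rho (linear_flow X \<alpha> t z) = torus (x + t *\<^sub>R direction \<alpha>)"
  using linear_flow_trajectory(1)[OF assms(1-3)] assms rho_eq[of z j x]
  unfolding trajectory_def continuous_path_def
  by (auto simp: closed_segment_eq_real_ivl translate_torus)

lemma hitting_time_le: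
  fixes p q p' q' :: int
  assumes K: "segments_meet K" "K > 0" and \<alpha>: "\<alpha> \<noteq> 0"
    and z: "z \<in> points X - singular_leaves X \<alpha>" and r: "0 < r" "r < 1"
    and c: "consecutive \<alpha> q p q' p'" "1 \<le> q" "q < q'" and q': "2 * K / r \<le> of_int q'"
  shows "hitting_time X \<alpha> z r \<le> ereal (r + K / (cos (arctan \<alpha>) * \<bar>of_int q * \<alpha> - of_int p\<bar>))"
  unfolding hitting_time_def
proof (rule SUP_least)
  fix z' assume z': "z' \<in> points X"
  define D where "D = cos (arctan \<alpha>) * \<bar>of_int q * \<alpha> - of_int p\<bar>"
  have D: "D > 0"
    using c cos_arctan_pos[of \<alpha>] unfolding D_def consecutive_def by auto
  \<comment> \<open>The orbit piece starts at time r, since only later times count, and lasts just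
    long enough for its image to have length at least K.\<close>
  define T where "T = r + K / D"
  have T: "r < T" unfolding T_def using K(2) D by simp
  obtain \<eta> where \<eta>: "is_segment X \<lparr>seg_start = 0, seg_end = r / 2, seg_path = \<eta>, seg_velocity = vector [1, 0]\<rparr>"
    "\<And>t. t \<in> {0<..<r / 2} \<Longrightarrow> Dist X (\<eta> t) z' < r"
    using horizontal_segment_near[OF z' r] by blast
  obtain j x where x: "(j, x) \<in> z" using point_nonempty z by blast
  have traj: "trajectory X \<alpha> z T (\<lambda>s. linear_flow X \<alpha> s z)"
    using linear_flow_trajectory(1)[OF \<alpha> z] T r by simp
  have H: "is_segment X \<lparr>seg_start = r, seg_end = T, seg_path = \<lambda>s. linear_flow X \<alpha> s z, seg_velocity = direction \<alpha>\<rparr>"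
  proof (rule linear_segment[OF T])
    show "continuous_path X {r<..<T} (\<lambda>s. linear_flow X \<alpha> s z)"
      using traj T r unfolding trajectory_def
      by (auto simp: closed_segment_eq_real_ivl intro: continuous_path_subset)
    fix s assume "s \<in> {r<..<T}"
    then show "linear_flow X \<alpha> s z \<notin> conical_points X"
        "rho (linear_flow X \<alpha> s z) = torus (x + s *\<^sub>R direction \<alpha>)"
      using linear_flow_trajectory(2)[OF \<alpha> z, of T s] linear_flow_rho(2)[OF \<alpha> z _ x, of s] r by auto
  qed
  have "K \<le> (T - r) * D" unfolding T_def using D by simp
  moreover have "K \<le> (r / 2 - 0) * of_int q'" using q' r by (simp add: pos_divide_le_eq mult.commute)
  ultimately have "(\<lambda>s. linear_flow X \<alpha> s z) ` {r<..<T} \<inter> \<eta> ` {0<..<r / 2} \<noteq> {}"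
    using flow_meets_horizontal_segment[OF K(1) c H \<eta>(1)] unfolding D_def by blast
  then obtain s t where st: "s \<in> {r<..<T}" "t \<in> {0<..<r / 2}" "linear_flow X \<alpha> s z = \<eta> t" by blast
  then have "ereal s \<in> {ereal t |t. r < t \<and> Dist X (linear_flow X \<alpha> t z) z' < r}"
    using \<eta>(2) by auto
  then have "Inf {ereal t |t. r < t \<and> Dist X (linear_flow X \<alpha> t z) z' < r} \<le> ereal s"
    by (rule Inf_lower)
  also have "\<dots> \<le> ereal T" using st(1) by simp
  finally show "Inf {ereal t |t. r < t \<and> Dist X (linear_flow X \<alpha> t z) z' < r}
      \<le> ereal (r + K / (cos (arctan \<alpha>) * \<bar>of_int q * \<alpha> - of_int p\<bar>))"
    unfolding T_def D_def .
qed

text \<open>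
  The linear form \<open>q x - p y\<close> is well defined modulo \<open>1\<close> on the surface. Along the flow it changes at
  speed \<open>cos (arctan \<alpha>) * \<bar>q \<alpha> - p\<bar>\<close>, and the target is a point where it differs by \<open>1/2\<close> from
  its value at the start.
\<close>

lemma hitting_time_ge:
  fixes p q :: int
  assumes \<alpha>: "\<alpha> \<notin> \<rat>" and z: "z \<in> points X - singular_leaves X \<alpha>"
    and r: "0 < r" "r * (of_int \<bar>q\<bar> + of_int \<bar>p\<bar>) \<le> 1 / 8" and q: "q \<noteq> 0"
  shows "ereal (1 / (4 * (cos (arctan \<alpha>) * \<bar>of_int q * \<alpha> - of_int p\<bar>))) \<le> hitting_time X \<alpha> z r"
proof -
  have \<alpha>0: "\<alpha> \<noteq> 0" using \<alpha> by auto
  define F :: "real^2 \<Rightarrow> real" where "F v = of_int q * v $ 1 - of_int p * v $ 2" for v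
  have F_torus: "F v - F w \<in> \<int>" if "torus v = torus w" for v w
  proof -
    have "F v - F w = of_int q * (v $ 1 - w $ 1) - of_int p * (v $ 2 - w $ 2)"
      unfolding F_def by (simp add: algebra_simps)
    then show ?thesis using that by (simp add: torus_eq_iff)
  qed
  have F_norm: "\<bar>F v - F w\<bar> \<le> (of_int \<bar>q\<bar> + of_int \<bar>p\<bar>) * norm (v - w)" for v w
  proof -
    have "\<bar>F v - F w\<bar> = \<bar>of_int q * (v - w) $ 1 - of_int p * (v - w) $ 2\<bar>"
      unfolding F_def by (simp add: algebra_simps)
    also have "\<dots> \<le> \<bar>of_int q\<bar> * \<bar>(v - w) $ 1\<bar> + \<bar>of_int p\<bar> * \<bar>(v - w) $ 2\<bar>"
      using abs_triangle_ineq4 by (simp add: abs_mult[symmetric])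
    also have "\<dots> \<le> \<bar>of_int q\<bar> * norm (v - w) + \<bar>of_int p\<bar> * norm (v - w)"
      by (intro add_mono mult_left_mono component_le_norm_cart) auto
    finally show ?thesis by (simp add: algebra_simps)
  qed
  define D where "D = cos (arctan \<alpha>) * \<bar>of_int q * \<alpha> - of_int p\<bar>"
  have D: "D > 0"
    unfolding D_def using irrational_combination_nonzero[OF \<alpha> q] cos_arctan_pos[of \<alpha>] by simp
  have F_dir: "\<bar>F (direction \<alpha>)\<bar> = D"
  proof -
    have "F (direction \<alpha>) = cos (arctan \<alpha>) * (of_int q * \<alpha> - of_int p)"
      unfolding F_def direction_eq by (simp add: algebra_simps)
    then show ?thesis unfolding D_def using cos_arctan_pos[of \<alpha>] by (simp add: abs_mult)
  qed
  obtain j x0 where x0: "(j, x0) \<in> z" using point_nonempty z by blast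
  have j: "j \<in> tiles X" using point_mem_tile_points[OF _ x0, of X] z by (auto simp: tile_points_iff)
  \<comment> \<open>A point on the bottom side with \<open>F x\<close> congruent to
    \<open>F x0 + 1/2\<close> modulo 1: multiplying the fractional part by \<open>q\<close> changes
    the value only by an integer multiple of \<open>q\<close>.\<close>
  define x :: "real^2" where "x = vector [frac ((F x0 + 1/2) / of_int q), 0]"
  have xt: "(j, x) \<in> tile_points X"
    using j by (auto simp: tile_points_iff x_def forall_2 less_imp_le[OF frac_lt_1])
  define z' where "z' = point_of X j x"
  have z': "z' \<in> points X" "(j, x) \<in> z'"
    unfolding z'_def using point_of_in_points[OF xt] mem_point_of[OF xt] by auto
  have "F x = of_int q * frac ((F x0 + 1/2) / of_int q)" by (simp add: F_def x_def)
  also have "\<dots> = F x0 + 1/2 - of_int (q * \<lfloor>(F x0 + 1/2) / of_int q\<rfloor>)"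
    using q by (simp add: frac_def right_diff_distrib)
  finally have "F x = F x0 + 1/2 - of_int (q * \<lfloor>(F x0 + 1/2) / of_int q\<rfloor>)" .
  then obtain m0 :: int where m0: "F x = F x0 + 1/2 - of_int m0" by blast
  have late: "1 / (4 * D) \<le> t" if t: "t > r" "Dist X (linear_flow X \<alpha> t z) z' < r" for t
  proof -
    have flow: "linear_flow X \<alpha> t z \<in> points X"
        "rho (linear_flow X \<alpha> t z) = torus (x0 + t *\<^sub>R direction \<alpha>)"
      using linear_flow_rho[OF \<alpha>0 z _ x0, of t] t r by auto
    obtain k y where y: "(k, y) \<in> linear_flow X \<alpha> t z" using point_nonempty[OF flow(1)] .
    then have "torus y = torus (x0 + t *\<^sub>R direction \<alpha>)" using rho_eq[OF flow(1)] flow(2) by simp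
    then obtain m1 :: int where m1: "F y - F (x0 + t *\<^sub>R direction \<alpha>) = of_int m1"
      using F_torus by (metis Ints_cases)
    obtain l where l: "broken_path X (linear_flow X \<alpha> t z) z' l" "l < r"
      using Dist_less_imp_path[OF path_connected flow(1) z'(1) t(2)] .
    obtain w where w: "w \<in> torus x" "norm (w - y) \<le> l" using broken_path_torus[OF l(1) y z'(2)] by blast
    obtain m2 :: int where m2: "F w - F x = of_int m2"
      using F_torus[OF torus_eqI[OF w(1)]] by (metis Ints_cases)
    have "\<bar>F w - F y\<bar> \<le> (of_int \<bar>q\<bar> + of_int \<bar>p\<bar>) * norm (w - y)" by (rule F_norm)
    also have "\<dots> \<le> (of_int \<bar>q\<bar> + of_int \<bar>p\<bar>) * r" using w(2) l(2) by (intro mult_left_mono) auto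
    finally have close: "\<bar>F w - F y\<bar> \<le> 1 / 8" using r(2) by (simp add: mult.commute)
    have lin: "F (x0 + t *\<^sub>R direction \<alpha>) = F x0 + t * F (direction \<alpha>)"
      unfolding F_def by (simp add: algebra_simps)
    have "F w - F y = 1/2 - t * F (direction \<alpha>) + of_int (m2 - m0 - m1)"
      using m0 m1 m2 lin by simp
    moreover have "\<bar>1/2 + real_of_int m\<bar> \<ge> 1/2" for m :: int
      by (cases "m \<ge> 0") linarith+
    from this[of "m2 - m0 - m1"] have "\<bar>1/2 + real_of_int (m2 - m0 - m1)\<bar> \<ge> 1/2" .
    \<comment> \<open>Being close to the target costs at most 1/8 of the offset 1/2 modulo 1, so the
      flow must have changed the form by at least 3/8; 1/4 is a convenient weaker value.\<close>
    ultimately have "1/4 \<le> \<bar>t * F (direction \<alpha>)\<bar>" using close by linarith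
    also have "\<dots> = t * D" using F_dir t r by (simp add: abs_mult)
    finally show ?thesis using D by (simp add: pos_divide_le_eq mult_ac)
  qed
  have "ereal (1 / (4 * D)) \<le> Inf {ereal t |t. t > r \<and> Dist X (linear_flow X \<alpha> t z) z' < r}"
    by (rule Inf_greatest) (use late in auto)
  also have "\<dots> \<le> hitting_time X \<alpha> z r"
    unfolding hitting_time_def by (rule SUP_upper[OF z'(1)])
  finally show ?thesis unfolding D_def .
qed

text \<open>Keeps hitting times positive, where \<open>ereal_log\<close> is monotone and agrees with
  the logarithm.\<close>

lemma hitting_time_ge_radius:
  assumes "z \<in> points X"
  shows "ereal r \<le> hitting_time X \<alpha> z r"
proof -
  have "ereal r \<le> Inf {ereal t |t. t > r \<and> Dist X (linear_flow X \<alpha> t z) z < r}"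
    by (rule Inf_greatest) auto
  also have "\<dots> \<le> hitting_time X \<alpha> z r"
    unfolding hitting_time_def by (rule SUP_upper[OF assms])
  finally show ?thesis .
qed

end

section \<open>The hitting exponent\<close>

text \<open>Each denominator admits finitely many numerators, as \<open>p\<close> is within 1 of q
  \<alpha>. So infinitely many approximations need unbounded denominators; \<open>M\<close> bounds
  the numerators for denominators up to \<open>N\<close>.\<close>

lemma approximations_unbounded:
  assumes inf: "infinite (approximations \<alpha> w)" and w: "w > 0"
  obtains p q :: int where "(p, q) \<in> approximations \<alpha> w" "N < q"
proof -
  define M where "M = (\<lceil>\<bar>\<alpha>\<bar>\<rceil> + 1) * N"
  have "\<not> approximations \<alpha> w \<subseteq> {- M .. M} \<times> {0..N}"
    using inf finite_subset by blast
  then obtain p q where "(p, q) \<in> approximations \<alpha> w" "(p, q) \<notin> {- M .. M} \<times> {0..N}" by fast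
  then have pq: "(p, q) \<in> approximations \<alpha> w" "\<not> (0 \<le> q \<and> q \<le> N \<and> \<bar>p\<bar> \<le> M)"
    by auto
  have q: "q > 0" "\<bar>of_int q * \<alpha> - of_int p\<bar> < of_int q powr (- w)"
    using pq(1) unfolding approximations_iff by auto
  have "\<bar>p\<bar> \<le> M" if "q \<le> N"
  proof -
    have "of_int q powr (- w) \<le> (of_int q :: real) powr 0" using q w by (intro powr_mono) auto
    then have "\<bar>of_int p\<bar> < 1 + of_int q * \<bar>\<alpha>\<bar>"
      using q abs_mult[of "of_int q" \<alpha>] by simp
    also have "\<dots> \<le> of_int N + of_int N * of_int \<lceil>\<bar>\<alpha>\<bar>\<rceil>"
      using q that by (intro add_mono mult_mono) auto
    finally have "real_of_int \<bar>p\<bar> < of_int ((\<lceil>\<bar>\<alpha>\<bar>\<rceil> + 1) * N)" by (simp add: algebra_simps)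
    then show ?thesis unfolding M_def by linarith
  qed
  with pq q show ?thesis using that by force
qed

lemma ereal_log_ge:
  assumes "ereal x \<le> T" "x > 0"
  shows "ereal (ln x) \<le> ereal_log T"
  using assms by (cases T) (auto simp: ereal_log_def)

lemma ereal_log_le:
  assumes "ereal y \<le> T" "T \<le> ereal x" "y > 0"
  shows "ereal_log T \<le> ereal (ln x)"
  using assms by (cases T) (auto simp: ereal_log_def)

text \<open>A bound c r^(-w) has exponent w whatever the constant: the quotient is w - ln c / ln r,
  and ln r tends to minus infinity.\<close>

lemma log_power_rate_tendsto:
  fixes c w :: real
  shows "((\<lambda>r. (ln c - w * ln r) / (- ln r)) \<longlongrightarrow> w) (at_right 0)"
proof -
  have "((\<lambda>r. ln c / ln r) \<longlongrightarrow> 0) (at_right 0)"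
    using filterlim_at_bot_imp_at_infinity[OF ln_at_0] by (intro tendsto_divide_0[OF tendsto_const])
  from tendsto_diff[OF tendsto_const[of w] this]
  have lim: "((\<lambda>r. w - ln c / ln r) \<longlongrightarrow> w) (at_right 0)" by simp
  have "\<forall>\<^sub>F r in at_right 0. r \<in> {0<..<1::real}" by (intro eventually_at_right_real) auto
  then have "\<forall>\<^sub>F r in at_right 0. w - ln c / ln r = (ln c - w * ln r) / (- ln r)"
    by eventually_elim (auto simp: field_simps)
  with lim show ?thesis by (rule Lim_transform_eventually)
qed

context origami_surface
begin

lemma hitting_exponent_le:
  assumes K: "segments_meet K" "K > 0" and \<alpha>: "\<alpha> \<notin> \<rat>"
    and z: "z \<in> points X - singular_leaves X \<alpha>" and w: "diophantine_type \<alpha> < ereal w"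
  shows "hitting_exponent X \<alpha> z \<le> ereal w"
proof -
  have \<alpha>0: "\<alpha> \<noteq> 0" using \<alpha> by auto
  have w1: "w > 1" using diophantine_type_ge_1[OF \<alpha>] w by (metis ereal_less_eq(3) less_ereal.simps(1) one_ereal_def order_le_less_trans)
  obtain c where c: "c > 0" "\<And>q p :: int. q > 0 \<Longrightarrow> coprime p q \<Longrightarrow>
      c * of_int q powr (- w) \<le> \<bar>of_int q * \<alpha> - of_int p\<bar>"
    using approximation_lower_bound[OF \<alpha> _ approximations_finite_above_type[OF w]] w1 by auto
  define D where "D = cos (arctan \<alpha>)"
  have D: "D > 0" unfolding D_def by (rule cos_arctan_pos)
  \<comment> \<open>The summand 1 absorbs r, which is at most r^(-w). The other comes from K / (D |q
    \<alpha> - p|), the lower bound with constant \<open>c\<close>, and q < 2K/r.\<close>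
  define C where "C = 1 + K * (2 * K) powr w / (D * c)"
  have C: "C > 0" unfolding C_def using K c D by (intro add_pos_nonneg) auto
  \<comment> \<open>r < 2K makes the threshold 2K/r exceed 1, as the choice of convergents demands;
    r < 1 lets the horizontal segment fit into a tile.\<close>
  have bound: "hitting_time X \<alpha> z r \<le> ereal (C * r powr (- w))" if r: "0 < r" "r < min 1 (2 * K)" for r
  proof -
    have "1 < 2 * K / r" using r by simp
    then obtain q p q' p' where qp: "consecutive \<alpha> q p q' p'" "1 \<le> q" "of_int q < 2 * K / r" "2 * K / r \<le> of_int q'"
      using consecutive_around[OF \<alpha>] by blast
    have "q < q'" using qp(3,4) by linarith
    have "coprime p q"
    proof (rule coprimeI)
      fix d assume "d dvd p" "d dvd q"
      then have "d dvd \<bar>q * p' - p * q'\<bar>" by simp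
      then show "is_unit d" using qp(1) unfolding consecutive_def by simp
    qed
    then have "c * of_int q powr (- w) \<le> \<bar>of_int q * \<alpha> - of_int p\<bar>" using c(2) qp(2) by simp
    moreover have "c * (2 * K / r) powr (- w) \<le> c * of_int q powr (- w)"
      using c(1) qp(2,3) w1 by (intro mult_left_mono powr_mono2') auto
    ultimately have \<delta>: "c * (2 * K / r) powr (- w) \<le> \<bar>of_int q * \<alpha> - of_int p\<bar>" by linarith
    have pos: "c * (2 * K / r) powr (- w) > 0" using c K r by simp
    have "r + K / (D * \<bar>of_int q * \<alpha> - of_int p\<bar>) \<le> 1 * r powr (- w) + K / (D * (c * (2 * K / r) powr (- w)))"
    proof (intro add_mono divide_left_mono mult_left_mono \<delta> mult_pos_pos)
      have "1 powr (- w) \<le> r powr (- w)" using r w1 by (intro powr_mono2') auto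
      then show "r \<le> 1 * r powr (- w)" using r by simp
    qed (use K D pos c(1) \<delta> in auto)
    also have "\<dots> = C * r powr (- w)"
      unfolding C_def using K r by (simp add: powr_minus powr_divide field_simps)
    finally show ?thesis
      using hitting_time_le[OF K \<alpha>0 z _ _ qp(1,2) \<open>q < q'\<close> qp(4)] r unfolding D_def
      by (meson ereal_less_eq(3) order_trans min_less_iff_conj)
  qed
  have log_bound: "ereal_log (hitting_time X \<alpha> z r) / ereal (- ln r) \<le> ereal ((ln C - w * ln r) / (- ln r))"
    if r: "0 < r" "r < min 1 (2 * K)" for r
  proof -
    have "ereal_log (hitting_time X \<alpha> z r) \<le> ereal (ln (C * r powr (- w)))"
      using hitting_time_ge_radius bound[OF r] r z by (intro ereal_log_le) auto
    also have "ln (C * r powr (- w)) = ln C - w * ln r"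
      using C r by (simp add: ln_mult ln_powr)
    finally have "ereal_log (hitting_time X \<alpha> z r) / ereal (- ln r) \<le> ereal (ln C - w * ln r) / ereal (- ln r)"
      using r by (intro ereal_divide_right_mono) auto
    then show ?thesis using r by simp
  qed
  have lim: "((\<lambda>r. ereal ((ln C - w * ln r) / (- ln r))) \<longlongrightarrow> ereal w) (at_right 0)"
    using log_power_rate_tendsto by simp
  have "\<forall>\<^sub>F r in at_right 0. r \<in> {0<..<min 1 (2 * K)}"
    using K by (intro eventually_at_right_real) auto
  then have "\<forall>\<^sub>F r in at_right 0. ereal_log (hitting_time X \<alpha> z r) / ereal (- ln r) \<le> ereal ((ln C - w * ln r) / (- ln r))"
    by eventually_elim (use log_bound in auto)
  then have "hitting_exponent X \<alpha> z \<le> Limsup (at_right 0) (\<lambda>r. ereal ((ln C - w * ln r) / (- ln r)))"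
    unfolding hitting_exponent_def by (rule Limsup_mono)
  also have "\<dots> = ereal w" using lim by (intro lim_imp_Limsup) auto
  finally show ?thesis .
qed

text \<open>For a limit superior it is enough to have one radius, of order 1/q, for each
  approximation p/q. If the exponent were below some v < w, all small radii would obey the rate v,
  including those radii, which force rates near w.\<close>

lemma hitting_exponent_ge:
  assumes \<alpha>: "\<alpha> \<notin> \<rat>" and z: "z \<in> points X - singular_leaves X \<alpha>"
    and w: "w > 0" "ereal w < diophantine_type \<alpha>"
  shows "ereal w \<le> hitting_exponent X \<alpha> z"
proof (rule ccontr)
  assume "\<not> ereal w \<le> hitting_exponent X \<alpha> z"
  then have "hitting_exponent X \<alpha> z < ereal w" by simp
  then obtain v where "hitting_exponent X \<alpha> z < ereal v" "ereal v < ereal w"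
    using ereal_dense2 by blast
  then have v: "hitting_exponent X \<alpha> z < ereal v" "v < w" by simp_all
  have inf: "infinite (approximations \<alpha> w)" using approximations_infinite_below_type[OF w(2)] .
  \<comment> \<open>An approximation satisfies |p| <= 1 + q |\<alpha>|, hence 8 (q + |p|) <= E q.
    With r = 1 / (8 (q + |p|)) this gives q >= 1 / (E r), and \<open>C\<close> is what then remains
    of q^w / 4.\<close>
  define E where "E = 8 * (\<bar>\<alpha>\<bar> + 2)"
  have E: "E > 0" unfolding E_def by (simp add: add_nonneg_pos)
  define C where "C = (1 / E) powr w / 4"
  have C: "C > 0" unfolding C_def using E by simp
  have "\<forall>\<^sub>F r in at_right 0. (ln C - w * ln r) / (- ln r) > v"
    using order_tendstoD(1)[OF log_power_rate_tendsto v(2)] .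
  moreover have "\<forall>\<^sub>F r in at_right 0. ereal_log (hitting_time X \<alpha> z r) / ereal (- ln r) < ereal v"
    using v(1) unfolding hitting_exponent_def by (rule Limsup_lessD)
  moreover have "\<forall>\<^sub>F r in at_right 0. r \<in> {0<..<1::real}"
    by (intro eventually_at_right_real) auto
  ultimately have "\<forall>\<^sub>F r in at_right 0. 0 < r \<and> r < 1 \<and> (ln C - w * ln r) / (- ln r) > v \<and>
      ereal_log (hitting_time X \<alpha> z r) / ereal (- ln r) < ereal v"
    by eventually_elim auto
  then obtain b where b: "b > 0" "\<And>r. 0 < r \<Longrightarrow> r < b \<Longrightarrow> r < 1 \<and> (ln C - w * ln r) / (- ln r) > v \<and>
      ereal_log (hitting_time X \<alpha> z r) / ereal (- ln r) < ereal v"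
    unfolding eventually_at_right_field by blast
  \<comment> \<open>The denominator exceeds 1/b so that r, which is at most 1/q, falls below
    \<open>b\<close>.\<close>
  obtain p q where pq: "(p, q) \<in> approximations \<alpha> w" "\<lceil>1 / b\<rceil> < q"
    using approximations_unbounded[OF inf w(1)] .
  have q: "q > 0" "\<bar>of_int q * \<alpha> - of_int p\<bar> < of_int q powr (- w)"
    using pq(1) unfolding approximations_iff by auto
  \<comment> \<open>The largest radius that \<open>hitting_time_ge\<close> allows for this p and
    q.\<close>
  define r :: real where "r = 1 / (8 * (of_int \<bar>q\<bar> + of_int \<bar>p\<bar>))"
  have r0: "r > 0" unfolding r_def using q by (simp add: add_pos_nonneg)
  have "1 / b < of_int q" using pq(2) by linarith
  then have "1 / of_int q < b" using b(1) q by (simp add: field_simps)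
  moreover have "r \<le> 1 / of_int q"
    unfolding r_def using q by (intro divide_left_mono) (auto intro!: mult_pos_pos add_pos_nonneg)
  ultimately have r: "r < 1" "(ln C - w * ln r) / (- ln r) > v"
      "ereal_log (hitting_time X \<alpha> z r) / ereal (- ln r) < ereal v"
    using b(2)[OF r0] by auto
  have "of_int q powr (- w) \<le> (of_int q :: real) powr 0" using q w by (intro powr_mono) auto
  then have "\<bar>of_int p\<bar> \<le> 1 + of_int q * \<bar>\<alpha>\<bar>"
    using q abs_mult[of "of_int q" \<alpha>] by simp
  then have "8 * (of_int \<bar>q\<bar> + of_int \<bar>p\<bar>) \<le> 8 * (of_int q + (of_int q + of_int q * \<bar>\<alpha>\<bar>))"
    using q by simp
  also have "\<dots> = E * of_int q" unfolding E_def by (simp add: algebra_simps)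
  finally have "1 / r \<le> E * of_int q" unfolding r_def by simp
  then have "1 / E * (1 / r) \<le> of_int q" using E r0 by (simp add: field_simps)
  then have "(1 / E * (1 / r)) powr w \<le> of_int q powr w"
    using E r0 w by (intro powr_mono2) auto
  moreover have "(1 / E * (1 / r)) powr w = (1 / E) powr w * r powr (- w)"
    using E r0 by (simp add: powr_mult powr_divide powr_minus inverse_eq_divide)
  ultimately have low: "C * r powr (- w) \<le> of_int q powr w / 4" unfolding C_def by simp
  define D where "D = cos (arctan \<alpha>) * \<bar>of_int q * \<alpha> - of_int p\<bar>"
  have D: "D > 0"
    unfolding D_def using irrational_combination_nonzero[OF \<alpha>, of q p] cos_arctan_pos[of \<alpha>] q by simp
  have "D \<le> 1 * of_int q powr (- w)"
    unfolding D_def using q by (intro mult_mono) auto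
  then have "1 / (of_int q powr (- w)) \<le> 1 / D" using D q(1) by (intro divide_left_mono) auto
  then have "of_int q powr w / 4 \<le> 1 / (4 * D)" using q by (simp add: powr_minus field_simps)
  with low have "ereal (C * r powr (- w)) \<le> ereal (1 / (4 * D))" by simp
  also have "\<dots> \<le> hitting_time X \<alpha> z r"
    unfolding D_def by (rule hitting_time_ge[OF \<alpha> z r0]) (use q in \<open>auto simp: r_def field_simps\<close>)
  finally have "ereal (ln (C * r powr (- w))) \<le> ereal_log (hitting_time X \<alpha> z r)"
    using C r0 by (intro ereal_log_ge) auto
  moreover have "ln (C * r powr (- w)) = ln C - w * ln r"
    using C r0 by (simp add: ln_mult ln_powr)
  ultimately have "ereal (ln C - w * ln r) / ereal (- ln r) \<le> ereal_log (hitting_time X \<alpha> z r) / ereal (- ln r)"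
    using r r0 by (intro ereal_divide_right_mono) auto
  then have "ereal ((ln C - w * ln r) / (- ln r)) \<le> ereal_log (hitting_time X \<alpha> z r) / ereal (- ln r)"
    using r r0 by simp
  then have "ereal v < ereal v" using r(2,3) by (meson ereal_less_eq(3) less_ereal.simps(1) order_less_le_trans order_less_trans)
  then show False by simp
qed

text \<open>A real exponent strictly between two different extended reals contradicts one of the two
  bounds; this also covers an infinite type.\<close>

lemma hitting_exponent_eq_type:
  assumes K: "segments_meet K" "K > 0" and \<alpha>: "\<alpha> \<notin> \<rat>"
    and z: "z \<in> points X - singular_leaves X \<alpha>"
  shows "hitting_exponent X \<alpha> z = diophantine_type \<alpha>"
proof (rule antisym)
  show "hitting_exponent X \<alpha> z \<le> diophantine_type \<alpha>"
  proof (rule ccontr)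
    assume "\<not> ?thesis"
    then have "diophantine_type \<alpha> < hitting_exponent X \<alpha> z" by simp
    then obtain w where "diophantine_type \<alpha> < ereal w" "ereal w < hitting_exponent X \<alpha> z"
      using ereal_dense2 by blast
    then show False using hitting_exponent_le[OF K \<alpha> z] by (meson leD)
  qed
  show "diophantine_type \<alpha> \<le> hitting_exponent X \<alpha> z"
  proof (rule ccontr)
    assume "\<not> ?thesis"
    \<comment> \<open>The maximum with 0 makes the intermediate exponent positive, as the lower
      bound requires; there is room for it because the type is at least 1.\<close>
    then have "max 0 (hitting_exponent X \<alpha> z) < diophantine_type \<alpha>"
      using order_less_le_trans[OF _ diophantine_type_ge_1[OF \<alpha>], of 0] by auto
    then obtain w where "max 0 (hitting_exponent X \<alpha> z) < ereal w" "ereal w < diophantine_type \<alpha>"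
      using ereal_dense2 by blast
    then show False using hitting_exponent_ge[OF \<alpha> z, of w] by (auto simp: zero_ereal_def dest: leD)
  qed
qed

end

theorem theorem4p1:
  fixes X :: "'q tiled_surface" and \<alpha> :: real and p :: "'q point"
  assumes "origami X"
    and "\<exists>K::real. K > 0 \<and>
      (\<forall>Y\<in>SL2Z_orbit X. \<forall>H V. is_segment Y H \<longrightarrow> is_segment Y V \<longrightarrow>
         seg_length H \<ge> K \<longrightarrow> seg_length V \<ge> K \<longrightarrow>
         (seg_slope H < -1 \<and> 0 < seg_slope V \<and> seg_slope V < 1) \<or>
         (-1 < seg_slope H \<and> seg_slope H < 0 \<and> seg_slope V > 1) \<longrightarrow>
         seg_trace H \<inter> seg_trace V \<noteq> {})"
    and "\<alpha> \<notin> \<rat>"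
    and "p \<in> points X - singular_leaves X \<alpha>"
  shows "hitting_exponent X \<alpha> p = diophantine_type \<alpha>"
proof -
  interpret origami_surface X by unfold_locales (rule assms(1))
  obtain K where "segments_meet K" "K > 0" using assms(2) unfolding segments_meet_def by blast
  then show ?thesis using hitting_exponent_eq_type assms(3,4) by blast
qed

end
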